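(* If $C$ is an arbitrary cyclic group, finite or infinite, then the wreath product $C \wr \mathbb{Z}$ is hereditarily conjugacy separable, but not $p$-hereditarily conjugacy separable for any prime $p$.
   Context: $C \wr \mathbb{Z}$ is the restricted wreath product $\left(\bigoplus_{\mathbb{Z}} C\right)\rtimes \mathbb{Z}$ with $\mathbb{Z}$ acting by shifting coordinates. A group $G$ is conjugacy separable (respectively, $p$-conjugacy separable) if for every pair of non-conjugate elements $f,g\in G$ there is a surjective homomorphism $\pi$ from $G$ onto a finite group (respectively, onto a finite $p$-group) such that $\pi(f)$ and $\pi(g)$ are not conjugate in the image. $G$ is hereditarily conjugacy separable if $G$ and each of its finite-index subgroups are conjugacy separable. $G$ is $p$-hereditarily conjugacy separable if $G$ is $p$-conjugacy separable and so is every subgroup $H \leq G$ containing some $N \unlhd G$ with $G/N$ a finite $p$-group.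
   Formalization: The claim "not p-hereditarily conjugacy separable for any prime p" is stated only for nontrivial C, since for trivial C the wreath product is ℤ, which is p-hereditarily conjugacy separable for every prime p. *)

theory Defs
  imports "HOL-Algebra.Product_Groups" "HOL-Computational_Algebra.Primes"
begin

text \<open>
  The action \<open>\<phi> h\<close> is meant to be an automorphism of \<open>N\<close>, depending homomorphically on \<open>h\<close>.
\<close>

definition semidirect_product ::
  "('a, 'c) monoid_scheme \<Rightarrow> ('b, 'd) monoid_scheme \<Rightarrow> ('b \<Rightarrow> 'a \<Rightarrow> 'a) \<Rightarrow> ('a \<times> 'b) monoid"
  where "semidirect_product N H \<phi> =
    \<lparr>carrier = carrier N \<times> carrier H,
     monoid.mult = (\<lambda>(n, h) (n', h'). (n \<otimes>\<^bsub>N\<^esub> \<phi> h n', h \<otimes>\<^bsub>H\<^esub> h')),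
     one = (\<one>\<^bsub>N\<^esub>, \<one>\<^bsub>H\<^esub>)\<rparr>"

definition shift :: "int \<Rightarrow> (int \<Rightarrow> 'a) \<Rightarrow> int \<Rightarrow> 'a"
  where "shift k f = (\<lambda>i. f (i - k))"

definition wreath_int :: "('a, 'c) monoid_scheme \<Rightarrow> ((int \<Rightarrow> 'a) \<times> int) monoid"
  where "wreath_int C = semidirect_product (sum_group UNIV (\<lambda>_. C)) integer_group shift"

definition conjugate :: "('a, 'c) monoid_scheme \<Rightarrow> 'a \<Rightarrow> 'a \<Rightarrow> bool"
  where "conjugate G f g \<longleftrightarrow> (\<exists>x\<in>carrier G. g = x \<otimes>\<^bsub>G\<^esub> f \<otimes>\<^bsub>G\<^esub> inv\<^bsub>G\<^esub> x)"

definition finite_group :: "('a, 'c) monoid_scheme \<Rightarrow> bool"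
  where "finite_group G \<longleftrightarrow> group G \<and> finite (carrier G)"

definition finite_p_group :: "nat \<Rightarrow> ('a, 'c) monoid_scheme \<Rightarrow> bool"
  where "finite_p_group p G \<longleftrightarrow> finite_group G \<and> (\<exists>n. order G = p ^ n)"

text \<open>
  A definition cannot quantify over the type of the finite target group. Taking targets with
  carrier in \<^typ>\<open>nat\<close> is no restriction, since every finite group is isomorphic to such a
  group; see \<open>finite_quotient_nat\<close> below.
\<close>

definition conjugacy_separable :: "('a, 'c) monoid_scheme \<Rightarrow> bool"
  where "conjugacy_separable G \<longleftrightarrow>
    (\<forall>f\<in>carrier G. \<forall>g\<in>carrier G. \<not> conjugate G f g \<longrightarrow>
      (\<exists>(Q :: nat monoid) \<pi>. finite_group Q \<and> \<pi> \<in> epi G Q \<and> \<not> conjugate Q (\<pi> f) (\<pi> g)))"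

definition p_conjugacy_separable :: "nat \<Rightarrow> ('a, 'c) monoid_scheme \<Rightarrow> bool"
  where "p_conjugacy_separable p G \<longleftrightarrow>
    (\<forall>f\<in>carrier G. \<forall>g\<in>carrier G. \<not> conjugate G f g \<longrightarrow>
      (\<exists>(Q :: nat monoid) \<pi>. finite_p_group p Q \<and> \<pi> \<in> epi G Q \<and> \<not> conjugate Q (\<pi> f) (\<pi> g)))"

definition hereditarily_conjugacy_separable :: "('a, 'c) monoid_scheme \<Rightarrow> bool"
  where "hereditarily_conjugacy_separable G \<longleftrightarrow>
    conjugacy_separable G \<and>
    (\<forall>H. subgroup H G \<and> finite (rcosets\<^bsub>G\<^esub> H) \<longrightarrow> conjugacy_separable (G\<lparr>carrier := H\<rparr>))"

definition p_hereditarily_conjugacy_separable :: "nat \<Rightarrow> ('a, 'c) monoid_scheme \<Rightarrow> bool"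
  where "p_hereditarily_conjugacy_separable p G \<longleftrightarrow>
    p_conjugacy_separable p G \<and>
    (\<forall>H. subgroup H G \<and> (\<exists>N. N \<lhd> G \<and> N \<subseteq> H \<and> finite_p_group p (G Mod N)) \<longrightarrow>
      p_conjugacy_separable p (G\<lparr>carrier := H\<rparr>))"

lemma finite_quotient_nat:
  fixes G :: "('a, 'c) monoid_scheme" and Q :: "'b monoid"
  assumes Q: "finite_group Q" and \<pi>: "\<pi> \<in> epi G Q"
    and f: "f \<in> carrier G" and g: "g \<in> carrier G" and nc: "\<not> conjugate Q (\<pi> f) (\<pi> g)"
  shows "\<exists>(Q' :: nat monoid) \<pi>'. finite_group Q' \<and> order Q' = order Q \<and> \<pi>' \<in> epi G Q' \<and>
    \<not> conjugate Q' (\<pi>' f) (\<pi>' g)"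
proof -
  interpret Q: group Q using Q by (simp add: finite_group_def)
  have fin: "finite (carrier Q)" using Q by (simp add: finite_group_def)
  obtain e :: "'b \<Rightarrow> nat" where e: "inj_on e (carrier Q)"
    using finite_imp_inj_to_nat_seg[OF fin] by blast
  define d where "d = the_inv_into (carrier Q) e"
  have de: "d (e x) = x" if "x \<in> carrier Q" for x
    using that e by (simp add: d_def the_inv_into_f_f)
  define Q' :: "nat monoid" where "Q' = \<lparr>carrier = e ` carrier Q,
    monoid.mult = (\<lambda>x y. e (d x \<otimes>\<^bsub>Q\<^esub> d y)), one = e \<one>\<^bsub>Q\<^esub>\<rparr>"
  have gQ': "group Q'"
  proof (rule groupI)
    fix x assume "x \<in> carrier Q'"
    then obtain a where a: "a \<in> carrier Q" "x = e a" by (auto simp: Q'_def)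
    show "\<exists>y\<in>carrier Q'. y \<otimes>\<^bsub>Q'\<^esub> x = \<one>\<^bsub>Q'\<^esub>"
      using a by (intro bexI[of _ "e (inv\<^bsub>Q\<^esub> a)"]) (auto simp: Q'_def de)
  qed (auto simp: Q'_def de Q.m_assoc)
  have mult: "e x \<otimes>\<^bsub>Q'\<^esub> e y = e (x \<otimes>\<^bsub>Q\<^esub> y)" if "x \<in> carrier Q" "y \<in> carrier Q" for x y
    using that by (simp add: Q'_def de)
  have iso: "e \<in> epi Q Q'"
    unfolding epi_def hom_def using mult by (auto simp: Q'_def)
  have inve: "inv\<^bsub>Q'\<^esub> (e x) = e (inv\<^bsub>Q\<^esub> x)" if "x \<in> carrier Q" for x
    using that by (intro group.inv_equality[OF gQ']) (auto simp: Q'_def de)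
  have pf: "\<pi> f \<in> carrier Q" "\<pi> g \<in> carrier Q"
    using \<pi> f g by (auto simp: epi_def)
  have nc': "\<not> conjugate Q' (e (\<pi> f)) (e (\<pi> g))"
  proof
    assume "conjugate Q' (e (\<pi> f)) (e (\<pi> g))"
    then obtain x where x: "x \<in> carrier Q"
      "e (\<pi> g) = e x \<otimes>\<^bsub>Q'\<^esub> e (\<pi> f) \<otimes>\<^bsub>Q'\<^esub> inv\<^bsub>Q'\<^esub> (e x)"
      by (auto simp: conjugate_def Q'_def)
    then have "e (\<pi> g) = e (x \<otimes>\<^bsub>Q\<^esub> \<pi> f \<otimes>\<^bsub>Q\<^esub> inv\<^bsub>Q\<^esub> x)"
      using pf by (simp add: inve mult)
    then have "\<pi> g = x \<otimes>\<^bsub>Q\<^esub> \<pi> f \<otimes>\<^bsub>Q\<^esub> inv\<^bsub>Q\<^esub> x"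
      using pf x(1) inj_onD[OF e] by simp
    with nc x(1) show False by (auto simp: conjugate_def)
  qed
  have "finite_group Q'" "order Q' = order Q"
    using gQ' fin e by (auto simp: finite_group_def Q'_def order_def card_image)
  moreover have "e \<circ> \<pi> \<in> epi G Q'" using epi_compose[OF \<pi> iso] .
  ultimately show ?thesis using nc' by (metis comp_apply)
qed

end

theory Submission
  imports Defs "HOL-Library.Poly_Mapping" "HOL-Algebra.Multiplicative_Group"
begin

text \<open>
  Let \<open>\<Lambda> = \<int>[t, t\<inverse>]\<close>. A generator of the cyclic group \<open>C\<close>, of order \<open>d\<close> (where \<open>d = 0\<close> stands for
  infinite order), induces a surjection of \<open>\<W> = \<Lambda> \<rtimes> \<int>\<close> onto \<open>C \<wr> \<int>\<close> with kernel \<open>d\<Lambda>\<close>, so a finite-index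
  subgroup of \<open>C \<wr> \<int>\<close> pulls back to a finite-index subgroup \<open>H\<close> of \<open>\<W>\<close> containing \<open>d\<Lambda>\<close>, and
  everything happens modulo \<open>d\<Lambda>\<close>. Let \<open>f = (m, k)\<close> and \<open>g = (m', l)\<close> be elements of \<open>H\<close>. If
  \<open>k \<noteq> l\<close>, a finite quotient of \<open>\<int>\<close> separates them. If \<open>k = l = 0\<close>, the conjugates of \<open>m\<close> are
  shifts \<open>t\<^sup>j m\<close>, and the ideal \<open>(q, 1 - t\<^sup>n)\<close> separates \<open>m'\<close> from them as soon as \<open>n\<close> exceeds
  the supports and \<open>q\<close> the coefficients. If \<open>k = l \<noteq> 0\<close>, put \<open>B = H \<inter> \<Lambda>\<close>: then \<open>f\<close> acts trivially
  on the finite group \<open>B / N\<close> where \<open>N = (1 - t\<^sup>k) B + q B + d\<Lambda>\<close>, its power \<open>f\<^sup>q\<close> is central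
  modulo \<open>N\<close>, and \<open>N \<langle>f\<^sup>q\<rangle>\<close> is a normal subgroup of finite index which works for suitable \<open>q\<close>.

  For the negative part take \<open>k = p + 1\<close>. In a finite \<open>p\<close>-quotient, \<open>t\<close> is a power of \<open>t\<^sup>k\<close>, hence
  \<open>1 - t\<close> becomes a multiple of \<open>1 - t\<^sup>k\<close> and \<open>(0, k)\<close>, \<open>(1 - t, k)\<close> become conjugate, although
  they are not conjugate in \<open>C \<wr> \<int>\<close>. So the wreath product is not even \<open>p\<close>-conjugacy separable.
\<close>

section \<open>Laurent polynomials modulo \<open>1 - t\<^sup>k\<close> and \<open>q\<close>\<close>

type_synonym laurent = "int \<Rightarrow>\<^sub>0 int"

abbreviation coef :: "laurent \<Rightarrow> int \<Rightarrow> int" where "coef \<equiv> poly_mapping.lookup"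
abbreviation supp :: "laurent \<Rightarrow> int set" where "supp \<equiv> Poly_Mapping.keys"

abbreviation T :: "int \<Rightarrow> laurent" where "T k \<equiv> Poly_Mapping.single k 1"

lemma T_mult: "T k * T l = T (k + l)"
  by (simp add: mult_single)

lemma T_mult_left: "T k * (T l * u) = T (k + l) * u"
  by (simp add: T_mult flip: mult.assoc)

lemma lookup_single_mult:
  fixes v :: laurent
  shows "coef (Poly_Mapping.single k c * v) i = c * coef v (i - k)"
proof -
  \<comment> \<open>The condition has the shape of the support premise that
    \<open>frag_induction\<close> consumes.\<close>
  have "coef (Poly_Mapping.single k c * v) i = c * coef v (i - k)" if "supp v \<subseteq> UNIV"
    using that
  proof (induction v rule: frag_induction)
    case (one x)
    then show ?case by (auto simp: mult_single lookup_single when_def)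
  qed (auto simp: right_diff_distrib lookup_minus)
  then show ?thesis by simp
qed

lemma lookup_of_int_mult: "coef (of_int q * v :: laurent) i = q * coef v i"
  by (simp add: lookup_single_mult flip: single_of_int)

lemma of_int_dvd_iff: "of_int q dvd (u :: laurent) \<longleftrightarrow> (\<forall>i. q dvd coef u i)"
proof
  assume "\<forall>i. q dvd coef u i"
  then have "u = of_int q * Poly_Mapping.map (\<lambda>c. c div q) u"
    by (intro poly_mapping_eqI) (auto simp: lookup_of_int_mult Poly_Mapping.map.rep_eq when_def in_keys_iff)
  then show "of_int q dvd u" by (rule dvdI)
qed (auto simp: lookup_of_int_mult)

text \<open>Telescoping handles \<open>s \<ge> 0\<close>; for negative \<open>s\<close> the unit
  \<open>- T (k * s)\<close> reduces the claim to \<open>- s\<close>.\<close>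

lemma one_minus_T_dvd: "1 - T k dvd 1 - T (k * s)"
proof -
  have nat: "1 - T k dvd 1 - T (k * int n)" for n
  proof (induction n)
    case (Suc n)
    have "1 - T (k * int (Suc n)) = (1 - T (k * int n)) + T (k * int n) * (1 - T k)"
      by (simp add: algebra_simps T_mult)
    then show ?case using Suc by (metis dvd_add dvd_triv_right)
  qed simp
  show ?thesis
  proof (cases "s \<ge> 0")
    case True
    then show ?thesis using nat[of "nat s"] by simp
  next
    case False
    have "1 - T (k * s) = - T (k * s) * (1 - T (k * int (nat (- s))))"
      using False by (simp add: algebra_simps T_mult)
    then show ?thesis using nat by (metis dvd_mult)
  qed
qed

text \<open>\<open>1 - T (- k)\<close> and \<open>1 - T k\<close> differ by a unit, so later
  arguments may shift by a positive amount.\<close>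

lemma one_minus_T_abs_dvd: "1 - T \<bar>k\<bar> dvd u \<longleftrightarrow> 1 - T k dvd u"
proof -
  have "1 - T \<bar>k\<bar> dvd 1 - T k" "1 - T k dvd 1 - T \<bar>k\<bar>"
    using one_minus_T_dvd[of "\<bar>k\<bar>" "sgn k"] one_minus_T_dvd[of k "sgn k"]
    by (simp_all add: abs_mult_sgn flip: abs_sgn)
  then show ?thesis by (meson dvd_trans)
qed

lemma T_cong_mod: "1 - T k dvd T i - T (i mod \<bar>k\<bar>)"
proof -
  have "T i - T (i mod \<bar>k\<bar>) = - T (i mod \<bar>k\<bar>) * (1 - T (\<bar>k\<bar> * (i div \<bar>k\<bar>)))"
    by (simp add: algebra_simps T_mult)
  then show ?thesis
    using one_minus_T_dvd[of "\<bar>k\<bar>"] one_minus_T_abs_dvd by (metis dvd_mult)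
qed

text \<open>Division with remainder: modulo \<open>1 - T k\<close> an exponent matters only modulo
  \<open>\<bar>k\<bar>\<close>, so every monomial can be moved into one window of that
  length.\<close>

lemma reduce_mod_one_minus_T:
  assumes "k \<noteq> 0"
  obtains r :: laurent where "1 - T k dvd u - r" "supp r \<subseteq> {0..<\<bar>k\<bar>}"
proof -
  have "\<exists>r. 1 - T k dvd u - r \<and> supp r \<subseteq> {0..<\<bar>k\<bar>}" if "supp u \<subseteq> UNIV"
    using that
  proof (induction u rule: frag_induction)
    case zero
    then show ?case by (intro exI[of _ 0]) auto
  next
    case (one i)
    then show ?case using assms T_cong_mod[of k i] by (intro exI[of _ "T (i mod \<bar>k\<bar>)"]) auto
  next
    case (diff a b)
    then obtain r s where rs: "1 - T k dvd a - r" "supp r \<subseteq> {0..<\<bar>k\<bar>}"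
      "1 - T k dvd b - s" "supp s \<subseteq> {0..<\<bar>k\<bar>}" by blast
    have "1 - T k dvd (a - b) - (r - s)"
      using dvd_diff[OF rs(1,3)] by (simp add: algebra_simps)
    then show ?case using keys_diff[of r s] rs by (intro exI[of _ "r - s"]) blast
  qed
  then show ?thesis using that by auto
qed

text \<open>
  Modulo \<open>q\<close>, a nonzero multiple of \<open>1 - t\<^sup>k\<close> has lowest and highest exponent at least
  \<open>\<bar>k\<bar>\<close> apart.
\<close>

lemma of_int_dvd_if_short:
  assumes "k \<noteq> 0" and dvd: "1 - T k dvd x - of_int q * w" and keys: "supp x \<subseteq> {a..<a + \<bar>k\<bar>}"
  shows "of_int q dvd (x :: laurent)"
proof -
  let ?k = "\<bar>k\<bar>"
  have "1 - T ?k dvd x - of_int q * w"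
    using dvd by (simp only: one_minus_T_abs_dvd)
  then obtain v where v: "x - of_int q * w = (1 - T ?k) * v" by (rule dvdE)
  have x: "coef x i = coef v i - coef v (i - ?k) + q * coef w i" for i
    using arg_cong[OF v, of "\<lambda>u. coef u i"]
    by (simp add: left_diff_distrib lookup_minus lookup_single_mult lookup_of_int_mult)
  have q_dvd_x: "q dvd coef x i \<longleftrightarrow> q dvd coef v i - coef v (i - ?k)" for i
    unfolding x by (simp add: dvd_add_left_iff)
  \<comment> \<open>\<open>S\<close> is the support of \<open>v\<close> modulo \<open>q\<close>. At
    \<open>Min S\<close> and at \<open>Max S + ?k\<close> the cofactor \<open>v\<close> and its
    shift cannot cancel, so \<open>x\<close> is nonzero modulo \<open>q\<close> at both places,
    which are too far apart for the window.\<close>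
  define S where "S = {i. \<not> q dvd coef v i}"
  have "S \<subseteq> supp v" by (auto simp: S_def in_keys_iff)
  then have fin: "finite S" by (rule finite_subset) simp
  have "S = {}"
  proof (rule ccontr)
    assume ne: "S \<noteq> {}"
    have MS: "Min S \<in> S" "Max S \<in> S" using ne fin by auto
    have "Min S - ?k \<notin> S" "Max S + ?k \<notin> S"
      using assms(1) Min_le[OF fin, of "Min S - ?k"] Max_ge[OF fin, of "Max S + ?k"] by linarith+
    with MS have "\<not> q dvd coef x (Min S)" "\<not> q dvd coef x (Max S + ?k)"
      using q_dvd_x by (auto simp: S_def dvd_diff_right_iff dvd_diff_left_iff)
    then have "Min S \<in> supp x" "Max S + ?k \<in> supp x" by (auto simp: in_keys_iff)
    then have "a \<le> Min S" "Max S < a" using keys by fastforce+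
    moreover have "Min S \<le> Max S" using MS fin by auto
    ultimately show False by simp
  qed
  then show ?thesis unfolding of_int_dvd_iff q_dvd_x by (auto simp: S_def)
qed

lemma of_int_dvd_small_imp_0:
  assumes "of_int q dvd (x :: laurent)" "\<And>i. \<bar>coef x i\<bar> < q"
  shows "x = 0"
proof (rule poly_mapping_eqI)
  fix i
  have "q dvd coef x i" using assms(1) by (simp add: of_int_dvd_iff)
  with assms(2)[of i] show "coef x i = coef 0 i"
    using dvd_imp_le_int[of "coef x i" q] by fastforce
qed

lemma coefficient_bound:
  obtains Q :: int where "0 < Q" "\<And>i. \<bar>coef (x :: laurent) i\<bar> < Q"
proof
  let ?A = "insert 0 ((\<lambda>i. \<bar>coef x i\<bar>) ` supp x)"
  show "0 < Max ?A + 1" by (meson Max_ge finite.intros finite_imageI finite_keys insertI1 zle_add1_eq_le)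
  show "\<bar>coef x i\<bar> < Max ?A + 1" for i
  proof -
    have "\<bar>coef x i\<bar> \<in> ?A" by (auto simp: in_keys_iff)
    then show ?thesis using Max_ge[of ?A "\<bar>coef x i\<bar>"] by simp
  qed
qed

text \<open>The remainder \<open>r\<close> of \<open>u\<close> has coefficients below a fixed
  \<open>Q\<close>. For \<open>q \<ge> Q\<close>, membership of \<open>u\<close> in the ideal (1 -
  t^k, q) forces \<open>q\<close> to divide \<open>r\<close>, hence \<open>r = 0\<close>.\<close>

lemma one_minus_T_dvd_if_dvd_mod:
  assumes "k \<noteq> 0"
  obtains Q where "0 < Q" "\<And>q w. q \<ge> Q \<Longrightarrow> 1 - T k dvd u - of_int q * w \<Longrightarrow> 1 - T k dvd u"
proof -
  obtain r where r: "1 - T k dvd u - r" "supp r \<subseteq> {0..<\<bar>k\<bar>}"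
    using reduce_mod_one_minus_T[OF assms] .
  obtain Q where Q: "0 < Q" "\<And>i. \<bar>coef r i\<bar> < Q" using coefficient_bound[of r] by blast
  show ?thesis
  proof (rule that[OF Q(1)])
    fix q w assume q: "q \<ge> Q" and u: "1 - T k dvd u - of_int q * w"
    have "1 - T k dvd r - of_int q * w"
      using dvd_diff[OF u r(1)] by simp
    then have "of_int q dvd r" using of_int_dvd_if_short[of k r q w 0] assms r by simp
    then have "r = 0" using of_int_dvd_small_imp_0 Q(2) q by (meson order_less_le_trans)
    then show "1 - T k dvd u" using r by simp
  qed
qed

text \<open>The quotient of \<Lambda> by 1 - t^k is torsion free, because multiplying by
  \<open>q\<close> keeps a remainder inside the window.\<close>

lemma one_minus_T_dvd_of_int_mult:
  assumes "k \<noteq> 0" "q \<noteq> 0" "1 - T k dvd of_int q * u"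
  shows "1 - T k dvd u"
proof -
  obtain r where r: "1 - T k dvd u - r" "supp r \<subseteq> {0..<\<bar>k\<bar>}"
    using reduce_mod_one_minus_T[OF assms(1)] .
  have "1 - T k dvd of_int q * u - of_int q * (u - r)"
    using assms(3) r(1) by (meson dvd_diff dvd_mult)
  then have "1 - T k dvd of_int q * r" by (simp add: algebra_simps)
  moreover have "supp (of_int q * r) \<subseteq> {0..<\<bar>k\<bar>}"
    using r(2) by (auto simp: in_keys_iff lookup_of_int_mult subset_iff)
  \<comment> \<open>This is the modulus 0: a multiple of 1 - t^k supported inside the window
    vanishes.\<close>
  ultimately have "of_int 0 dvd of_int q * r"
    using of_int_dvd_if_short[of k "of_int q * r" 0 0 0] assms(1) by simp
  then have "coef r i = 0" for i
    using assms(2) unfolding of_int_dvd_iff by (simp add: lookup_of_int_mult)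
  then have "r = 0" by (intro poly_mapping_eqI) simp
  then show ?thesis using r by simp
qed

section \<open>Finite index in the additive group of Laurent polynomials\<close>

definition finite_index :: "laurent set \<Rightarrow> bool"
  where "finite_index N \<longleftrightarrow> (\<exists>S. finite S \<and> (\<forall>u. \<exists>s\<in>S. u - s \<in> N))"

lemma finite_index_mono: "finite_index M \<Longrightarrow> M \<subseteq> N \<Longrightarrow> finite_index N"
  unfolding finite_index_def by (meson subsetD)

text \<open>The map \<open>c\<close> picks representatives. It serves below as an invariant with
  finitely many values that bounds the index of a subgroup.\<close>

lemma finite_indexE:
  assumes "finite_index M" "\<forall>u\<in>M. \<forall>v\<in>M. u - v \<in> M"
  obtains c :: "laurent \<Rightarrow> laurent" where "finite (range c)" "\<And>u v. c u = c v \<Longrightarrow> u - v \<in> M"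
proof -
  obtain S where S: "finite S" "\<And>u. \<exists>s\<in>S. u - s \<in> M"
    using assms(1) unfolding finite_index_def by blast
  have "\<exists>c. \<forall>u. c u \<in> S \<and> u - c u \<in> M"
    by (rule choice) (use S(2) in blast)
  then obtain c where c: "\<And>u. c u \<in> S \<and> u - c u \<in> M" by blast
  show ?thesis
  proof (rule that[of c])
    show "finite (range c)" by (rule finite_subset[OF _ S(1)]) (use c in auto)
    show "u - v \<in> M" if "c u = c v" for u v
      using bspec[OF bspec[OF assms(2), of "u - c u"], of "v - c u"] c[of u] c[of v] that by simp
  qed
qed

lemma finite_index_UNIV: "finite_index UNIV"
  unfolding finite_index_def by auto

text \<open>For \<open>B = UNIV\<close> this is the ideal generated by 1 - t^k and
  \<open>q\<close>.\<close>

definition cong_set :: "int \<Rightarrow> int \<Rightarrow> laurent set \<Rightarrow> laurent set"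
  where "cong_set k q B = {(1 - T k) * b + of_int q * c | b c. b \<in> B \<and> c \<in> B}"

text \<open>Dividing by 1 - t^k and reducing coefficients modulo \<open>q\<close> leaves one of
  finitely many remainders, collected in \<open>F\<close>. The two quotients \<open>v\<close> and
  \<open>w\<close> are then replaced modulo \<open>B\<close> by elements of
  \<open>S\<close>.\<close>

lemma finite_index_cong_set:
  assumes "k \<noteq> 0" "q > 0" "finite_index B"
  shows "finite_index (cong_set k q B)"
proof -
  obtain S where S: "finite S" "\<And>u. \<exists>s\<in>S. u - s \<in> B"
    using assms(3) unfolding finite_index_def by blast
  define F where "F = {r :: laurent. (\<forall>i. (i \<in> {0..<\<bar>k\<bar>} \<longrightarrow> coef r i \<in> {0..<q}) \<and>
    (i \<notin> {0..<\<bar>k\<bar>} \<longrightarrow> coef r i = 0))}"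
  have "finite (coef ` F)"
    by (rule finite_subset[OF _ finite_set_of_finite_funs[of "{0..<\<bar>k\<bar>}" "{0..<q}" 0]]) (auto simp: F_def)
  then have F: "finite F" by (rule finite_imageD) (simp add: inj_on_def lookup_inject)
  let ?S = "(\<lambda>(r, s, s'). r + (1 - T k) * s + of_int q * s') ` (F \<times> S \<times> S)"
  show ?thesis
    unfolding finite_index_def
  proof (intro exI[of _ ?S] conjI allI)
    show "finite ?S" using S F by blast
    fix u
    obtain r where r: "1 - T k dvd u - r" "supp r \<subseteq> {0..<\<bar>k\<bar>}"
      using reduce_mod_one_minus_T[OF assms(1)] .
    obtain v where v: "u - r = (1 - T k) * v" using r by blast
    define r' where "r' = Poly_Mapping.map (\<lambda>c. c mod q) r"
    have r': "coef r' i = coef r i mod q" for i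
      by (simp add: r'_def Poly_Mapping.map.rep_eq when_def)
    have "coef r i mod q = 0" if "i \<notin> {0..<\<bar>k\<bar>}" for i
      using that r(2) by (metis in_keys_iff mod_0 subsetD)
    then have "r' \<in> F" using assms(2) by (simp add: F_def r')
    have "of_int q dvd r - r'" by (simp add: of_int_dvd_iff lookup_minus r')
    then obtain w where w: "r - r' = of_int q * w" by blast
    obtain s s' where s: "s \<in> S" "v - s \<in> B" "s' \<in> S" "w - s' \<in> B" using S(2) by meson
    have "u - (r' + (1 - T k) * s + of_int q * s') = (u - r) + (r - r') - ((1 - T k) * s + of_int q * s')"
      by simp
    also have "\<dots> = (1 - T k) * (v - s) + of_int q * (w - s')" unfolding v w by (simp add: algebra_simps)
    finally have "\<exists>s\<in>?S. u - s \<in> {(1 - T k) * b + of_int q * c | b c. b \<in> B \<and> c \<in> B}"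
      using s \<open>r' \<in> F\<close>
      by (intro bexI[of _ "r' + (1 - T k) * s + of_int q * s'"] image_eqI[of _ _ "(r', s, s')"]) auto
    then show "\<exists>s\<in>?S. u - s \<in> cong_set k q B" unfolding cong_set_def .
  qed
qed

lemma support_bound:
  obtains D :: int where "0 \<le> D" "supp u \<subseteq> {- D..D}" "supp v \<subseteq> {- D..D}"
proof -
  define D where "D = Max (insert 0 (abs ` (supp u \<union> supp v)))"
  have le: "a \<le> D" if "a \<in> insert 0 (abs ` (supp u \<union> supp v))" for a
    unfolding D_def using that by (intro Max_ge) auto
  have "\<bar>i\<bar> \<le> D" if "i \<in> supp u \<union> supp v" for i using that by (intro le) auto
  then have "i \<in> {- D..D}" if "i \<in> supp u \<union> supp v" for i using that by (force simp: abs_le_iff)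
  then show ?thesis using that[OF le] by blast
qed

lemma T_cong: "n dvd j - r \<Longrightarrow> 1 - T n dvd T j - T r"
proof -
  assume "n dvd j - r"
  then obtain s where s: "j - r = n * s" by blast
  have "T j - T r = - T r * (1 - T (n * s))"
    by (simp add: algebra_simps T_mult flip: s)
  then show ?thesis using one_minus_T_dvd[of n s] by (metis dvd_mult)
qed

lemma one_minus_T_neq_0: "k \<noteq> 0 \<Longrightarrow> 1 - T k \<noteq> 0"
  by (metis lookup_one_zero lookup_single_not_eq eq_iff_diff_eq_0 zero_neq_one)

text \<open>
  \<open>geom k s\<close> is \<open>(1 - t\<^sup>k\<^sup>s) / (1 - t\<^sup>k)\<close>, so that \<open>(geom k s * m, k * s)\<close> is the power \<open>(m, k)\<^sup>s\<close>
  in the wreath product, also for negative \<open>s\<close>.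
\<close>

definition geom :: "int \<Rightarrow> int \<Rightarrow> laurent"
  where "geom k s = (SOME w. (1 - T k) * w = 1 - T (k * s))"

lemma geom: "(1 - T k) * geom k s = 1 - T (k * s)"
proof -
  obtain w where "1 - T (k * s) = (1 - T k) * w" using one_minus_T_dvd by (rule dvdE)
  then show ?thesis
    unfolding geom_def by (rule someI[of "\<lambda>w. (1 - T k) * w = 1 - T (k * s)", OF sym])
qed

text \<open>This is the law (m, k)^(s + r) = (m, k)^s (m, k)^r in the first coordinate. It is
  checked after multiplication by 1 - t^k, which cancels since \<open>k \<noteq> 0\<close>.\<close>

lemma geom_add:
  assumes "k \<noteq> 0"
  shows "geom k (s + r) = geom k s + T (k * s) * geom k r"
proof -
  have "(1 - T k) * geom k (s + r) = (1 - T k) * geom k s + T (k * s) * ((1 - T k) * geom k r)"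
    unfolding geom by (simp add: algebra_simps T_mult)
  also have "\<dots> = (1 - T k) * (geom k s + T (k * s) * geom k r)"
    by (simp add: algebra_simps)
  finally show ?thesis using one_minus_T_neq_0[OF assms] by (simp only: mult_cancel_left) simp
qed

lemma geom_0: "k \<noteq> 0 \<Longrightarrow> geom k 0 = 0"
  using geom_add[of k 0 0] by simp

lemma geom_1: "k \<noteq> 0 \<Longrightarrow> geom k 1 = 1"
  using geom[of k 1] one_minus_T_neq_0[of k] mult_cancel_left[of "1 - T k" "geom k 1" 1] by simp

section \<open>Finite-index subgroups of the wreath product of the integers\<close>

text \<open>The wreath product of two infinite cyclic groups: a Laurent polynomial stands for a
  finitely supported function on the integers, and multiplication by \<open>T k\<close> shifts it by
  \<open>k\<close>.\<close>

definition int_wreath :: "(laurent \<times> int) monoid"  (\<open>\<W>\<close>)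
  where "\<W> = \<lparr>carrier = UNIV, monoid.mult = (\<lambda>(u, k) (v, l). (u + T k * v, k + l)), one = (0, 0)\<rparr>"

lemma int_wreath_simps [simp]:
  "carrier \<W> = UNIV" "(u, k) \<otimes>\<^bsub>\<W>\<^esub> (v, l) = (u + T k * v, k + l)" "\<one>\<^bsub>\<W>\<^esub> = (0, 0)"
  by (simp_all add: int_wreath_def)

interpretation int_wreath: group \<W>
proof (rule groupI)
  fix x :: "laurent \<times> int"
  show "\<exists>y\<in>carrier \<W>. y \<otimes>\<^bsub>\<W>\<^esub> x = \<one>\<^bsub>\<W>\<^esub>"
    by (intro bexI[of _ "(- T (- snd x) * fst x, - snd x)"], cases x) simp_all
qed (auto simp: algebra_simps T_mult T_mult_left)

lemma inv_int_wreath [simp]: "inv\<^bsub>\<W>\<^esub> (u, k) = (- T (- k) * u, - k)"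
  by (rule int_wreath.inv_equality) simp_all

lemma conj_int_wreath:
  "(c, j) \<otimes>\<^bsub>\<W>\<^esub> (u, k) \<otimes>\<^bsub>\<W>\<^esub> inv\<^bsub>\<W>\<^esub> (c, j) = (c + T j * u - T k * c, k)"
  by (simp add: algebra_simps T_mult T_mult_left)

text \<open>Conjugacy modulo a normal subgroup is tested throughout by asking whether this product
  lies in the subgroup.\<close>

lemma conj_mult_inv_int_wreath:
  "(c, j) \<otimes>\<^bsub>\<W>\<^esub> (u, k) \<otimes>\<^bsub>\<W>\<^esub> inv\<^bsub>\<W>\<^esub> (c, j) \<otimes>\<^bsub>\<W>\<^esub> inv\<^bsub>\<W>\<^esub> (v, l) =
    (c + T j * u - T k * c - T (k - l) * v, k - l)"
  by (simp add: algebra_simps T_mult T_mult_left)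

lemma pow_int_wreath_base: "(u, 0) [^]\<^bsub>\<W>\<^esub> (n :: nat) = (of_nat n * u, 0)"
  by (induction n) (simp_all add: algebra_simps)

lemma pow_int_wreath_top: "(0, k) [^]\<^bsub>\<W>\<^esub> (n :: nat) = (0, k * int n)"
  by (induction n) (simp_all add: algebra_simps)

lemma int_pow_int_wreath_top: "(0, k) [^]\<^bsub>\<W>\<^esub> (n :: int) = (0, k * n)"
  by (cases n rule: int_cases2)
    (simp_all add: int_pow_int int_wreath.int_pow_neg_int pow_int_wreath_top)

text \<open>By the pigeonhole principle two of the cosets of x^0, ..., x^n agree, where n is the
  index, so some x^i with 0 < i \<le> n lies in \<open>H\<close>. The factorial of n is a common
  multiple of all such i.\<close>

lemma (in group) finite_index_pow:
  assumes "subgroup H G" "finite (rcosets H)"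
  obtains e :: nat where "e > 0" "\<And>x. x \<in> carrier G \<Longrightarrow> x [^] e \<in> H"
proof
  let ?n = "card (rcosets H)"
  show "fact ?n > (0 :: nat)" by simp
  fix x assume x: "x \<in> carrier G"
  let ?c = "\<lambda>i :: nat. H #> x [^] i"
  have "?c ` {..?n} \<subseteq> rcosets H" using x by (auto simp: RCOSETS_def)
  then have "card (?c ` {..?n}) \<le> ?n" by (rule card_mono[OF assms(2)])
  then have "\<not> inj_on ?c {..?n}" using pigeonhole[of ?c "{..?n}"] by simp
  then obtain i j where ij: "i < j" "j \<le> ?n" "?c i = ?c j"
    unfolding inj_on_def by (metis atMost_iff linorder_neqE_nat)
  have "x [^] j \<in> H #> x [^] i"
    using ij(3) x rcos_self[OF _ assms(1), of "x [^] j"] by simp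
  then have "x [^] j \<otimes> inv (x [^] i) \<in> H"
    using x assms(1) is_group by (simp add: subgroup.rcos_module_imp)
  moreover have "x [^] j = x [^] (j - i) \<otimes> x [^] i"
    using ij(1) x by (simp add: nat_pow_mult)
  ultimately have *: "x [^] (j - i) \<in> H" using x by (simp add: m_assoc)
  have "j - i dvd fact ?n" using ij by (intro dvd_fact) auto
  then obtain l where l: "fact ?n = (j - i) * l" by blast
  have "(x [^] (j - i)) [^] l \<in> H"
    by (induction l) (use * assms(1) in \<open>auto simp: subgroup.one_closed subgroup.m_closed\<close>)
  then show "x [^] (fact ?n :: nat) \<in> H"
    using x by (simp add: l nat_pow_pow)
qed

text \<open>Each value of \<open>c\<close> belongs to a single coset, so there are at most as many
  cosets as values; \<open>c\<close> itself may vary within a coset.\<close>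

lemma (in group) finite_rcosets:
  assumes "subgroup L G" "finite (c ` carrier G)"
    and "\<And>x y. x \<in> carrier G \<Longrightarrow> y \<in> carrier G \<Longrightarrow> c x = c y \<Longrightarrow> x \<otimes> inv y \<in> L"
  shows "finite (rcosets L)"
proof -
  have "rcosets L \<subseteq> (\<lambda>t. L #> (SOME x. x \<in> carrier G \<and> c x = t)) ` c ` carrier G"
  proof
    fix X assume "X \<in> rcosets L"
    then obtain x where x: "x \<in> carrier G" "X = L #> x" by (auto simp: RCOSETS_def)
    define y where "y = (SOME y. y \<in> carrier G \<and> c y = c x)"
    have y: "y \<in> carrier G" "c y = c x"
      using someI[of "\<lambda>y. y \<in> carrier G \<and> c y = c x" x] x by (auto simp: y_def)
    then have "x \<otimes> inv y \<in> L" using assms(3) x by simp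
    then have "x \<in> L #> y" using x y assms(1) by (simp add: subgroup.rcos_module is_group)
    then have "X = L #> y" using x y assms(1) repr_independence by simp
    then show "X \<in> (\<lambda>t. L #> (SOME x. x \<in> carrier G \<and> c x = t)) ` c ` carrier G"
      using x y_def by blast
  qed
  then show ?thesis using assms(2) by (meson finite_imageI finite_subset)
qed

section \<open>Finite-index subgroups containing \<open>d\<close>\<Lambda>\<close>

locale finite_index_subgroup =
  fixes H :: "(laurent \<times> int) set" and d :: int
  assumes subgroup: "subgroup H \<W>" and fin: "finite (rcosets\<^bsub>\<W>\<^esub> H)"
    and d_nonneg: "0 \<le> d" and of_int_d_mult: "(of_int d * u, 0) \<in> H"
begin

abbreviation "HG \<equiv> \<W>\<lparr>carrier := H\<rparr>"

sublocale HG: group HG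
  by (rule int_wreath.subgroup_imp_group[OF subgroup])

text \<open>The finite quotient by \<open>L\<close> kills \<open>d\<close>\<Lambda>, so it is also a
  quotient of the image of \<open>H\<close> in the wreath product with a cyclic group of order
  \<open>d\<close> (infinite if \<open>d = 0\<close>).\<close>

definition separated :: "laurent \<times> int \<Rightarrow> laurent \<times> int \<Rightarrow> bool"
  where "separated f g \<longleftrightarrow> (\<exists>L. L \<lhd> HG \<and> finite (rcosets\<^bsub>HG\<^esub> L) \<and> (\<forall>u. (of_int d * u, 0) \<in> L) \<and>
    (\<forall>x\<in>H. x \<otimes>\<^bsub>\<W>\<^esub> f \<otimes>\<^bsub>\<W>\<^esub> inv\<^bsub>\<W>\<^esub> x \<otimes>\<^bsub>\<W>\<^esub> inv\<^bsub>\<W>\<^esub> g \<notin> L))"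

lemma inv_HG: "x \<in> H \<Longrightarrow> inv\<^bsub>HG\<^esub> x = inv\<^bsub>\<W>\<^esub> x"
  using int_wreath.m_inv_consistent[OF subgroup] .

lemma H_mult: "(u, k) \<in> H \<Longrightarrow> (v, l) \<in> H \<Longrightarrow> (u + T k * v, k + l) \<in> H"
  using subgroup.m_closed[OF subgroup] by fastforce

lemma H_inv: "(u, k) \<in> H \<Longrightarrow> (- T (- k) * u, - k) \<in> H"
  using subgroup.m_inv_closed[OF subgroup] by fastforce

lemma H_zero: "(0, 0) \<in> H"
  using of_int_d_mult[of 0] by simp

text \<open>All conditions on \<open>L\<close> are put in coordinates; the invariant
  \<open>c\<close>, with finite range and fibres within cosets, replaces the finiteness of the
  index.\<close>

lemma separatedI:
  assumes L: "L \<subseteq> H" "\<And>u. (of_int d * u, 0) \<in> L"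
    and mult: "\<And>u k v l. (u, k) \<in> L \<Longrightarrow> (v, l) \<in> L \<Longrightarrow> (u + T k * v, k + l) \<in> L"
    and inv: "\<And>u k. (u, k) \<in> L \<Longrightarrow> (- T (- k) * u, - k) \<in> L"
    and conj: "\<And>c j u k. (c, j) \<in> H \<Longrightarrow> (u, k) \<in> L \<Longrightarrow> (c + T j * u - T k * c, k) \<in> L"
    and fin: "finite (range (c :: laurent \<times> int \<Rightarrow> 'b))"
    and c: "\<And>u k v l. (u, k) \<in> H \<Longrightarrow> (v, l) \<in> H \<Longrightarrow> c (u, k) = c (v, l) \<Longrightarrow>
      (u - T (k - l) * v, k - l) \<in> H \<Longrightarrow> (u - T (k - l) * v, k - l) \<in> L"
    and sep: "\<And>x. x \<in> H \<Longrightarrow> x \<otimes>\<^bsub>\<W>\<^esub> f \<otimes>\<^bsub>\<W>\<^esub> inv\<^bsub>\<W>\<^esub> x \<otimes>\<^bsub>\<W>\<^esub> inv\<^bsub>\<W>\<^esub> g \<notin> L"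
  shows "separated f g"
proof -
  have inv': "inv\<^bsub>HG\<^esub> x \<in> L" if "x \<in> L" for x
    using that inv L(1) inv_HG[of x] by (cases x) auto
  have sub: "subgroup L HG"
    using L(1) L(2)[of 0] mult inv' by unfold_locales auto
  moreover have "x \<otimes>\<^bsub>HG\<^esub> h \<otimes>\<^bsub>HG\<^esub> inv\<^bsub>HG\<^esub> x \<in> L" if "x \<in> H" "h \<in> L" for x h
    using conj[of "fst x" "snd x" "fst h" "snd h"] that conj_int_wreath[of "fst x" "snd x" "fst h" "snd h"]
    by (simp add: inv_HG)
  ultimately have "L \<lhd> HG" by (simp add: HG.normal_inv_iff)
  moreover have "finite (rcosets\<^bsub>HG\<^esub> L)"
  proof (rule HG.finite_rcosets[OF sub, of c])
    show "finite (c ` carrier HG)" using fin by (rule finite_subset[rotated]) auto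
    fix x y assume xy: "x \<in> carrier HG" "y \<in> carrier HG" "c x = c y"
    have "x \<otimes>\<^bsub>HG\<^esub> inv\<^bsub>HG\<^esub> y \<in> H"
      using HG.m_closed[OF xy(1) HG.inv_closed[OF xy(2)]] by simp
    then show "x \<otimes>\<^bsub>HG\<^esub> inv\<^bsub>HG\<^esub> y \<in> L"
      using xy c[of "fst x" "snd x" "fst y" "snd y"] inv_HG[of y]
      by (cases x; cases y) (simp add: T_mult_left)
  qed
  ultimately show ?thesis using L(2) sep unfolding separated_def by blast
qed

definition base :: "laurent set"
  where "base = {u. (u, 0) \<in> H}"

lemma base_add: "u \<in> base \<Longrightarrow> v \<in> base \<Longrightarrow> u + v \<in> base"
  using H_mult[of u 0 v 0] by (simp add: base_def)

lemma base_uminus: "u \<in> base \<Longrightarrow> - u \<in> base"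
  using H_inv[of u 0] by (simp add: base_def)

lemma base_diff: "u \<in> base \<Longrightarrow> v \<in> base \<Longrightarrow> u - v \<in> base"
  using base_add[of u "- v"] base_uminus[of v] by simp

lemma base_zero: "0 \<in> base"
  by (simp add: base_def H_zero)

lemma base_of_nat_mult: "u \<in> base \<Longrightarrow> of_nat n * u \<in> base"
  by (induction n) (simp_all add: base_zero base_add distrib_right)

lemma base_of_int_mult: "u \<in> base \<Longrightarrow> of_int n * u \<in> base"
  using base_of_nat_mult base_uminus by (cases n rule: int_cases2) force+

lemma conj_mem_H: "(c, j) \<in> H \<Longrightarrow> (u, k) \<in> H \<Longrightarrow> (c + T j * u - T k * c, k) \<in> H"
  using H_mult[OF H_mult H_inv, of c j u k c j] by (simp add: algebra_simps T_mult T_mult_left)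

text \<open>Conjugation by \<open>(c, j)\<close> acts on the base as t^j, whatever \<open>c\<close>
  is. The base need not be an ideal: only exponents occurring in \<open>H\<close> are
  available.\<close>

lemma base_T_mult:
  assumes "(c, j) \<in> H" "u \<in> base"
  shows "T j * u \<in> base"
  using conj_mem_H[of c j u 0] assms by (simp add: base_def)

lemma finite_index_base: "finite_index base"
proof -
  let ?c = "\<lambda>u. H #>\<^bsub>\<W>\<^esub> (u, 0)"
  have "range ?c \<subseteq> rcosets\<^bsub>\<W>\<^esub> H" by (auto simp: RCOSETS_def)
  then have *: "finite (range ?c)" using fin by (rule finite_subset)
  have "u - inv_into UNIV ?c (?c u) \<in> base" for u
  proof -
    have "?c u = ?c (inv_into UNIV ?c (?c u))" using f_inv_into_f[of "?c u" ?c UNIV] by simp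
    moreover have "(u, 0) \<in> ?c u" by (rule int_wreath.rcos_self) (use subgroup in auto)
    ultimately have mem: "(u, 0) \<in> ?c (inv_into UNIV ?c (?c u))" by simp
    have "(u, 0) \<otimes>\<^bsub>\<W>\<^esub> inv\<^bsub>\<W>\<^esub> (inv_into UNIV ?c (?c u), 0) \<in> H"
      by (rule subgroup.rcos_module_imp[OF subgroup int_wreath.is_group _ mem]) simp
    then show ?thesis by (simp add: base_def)
  qed
  then show ?thesis
    unfolding finite_index_def using * by (intro exI[of _ "inv_into UNIV ?c ` range ?c"]) blast
qed

text \<open>Powers of \<open>(u, 0)\<close> and \<open>(0, 1)\<close> give the two memberships: the
  first puts all multiples of \<open>e\<close> into the base, the second supplies conjugators
  shifting by multiples of \<open>e\<close>.\<close>

lemma exponent: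
  obtains e :: int where "e > 0" "\<And>u. of_int e * u \<in> base" "(0, e) \<in> H"
proof -
  obtain e :: nat where e: "e > 0" "\<And>x. x \<in> carrier \<W> \<Longrightarrow> x [^]\<^bsub>\<W>\<^esub> e \<in> H"
    using int_wreath.finite_index_pow[OF subgroup fin] by blast
  have "of_int (int e) * u \<in> base" for u
    using e(2)[of "(u, 0)"] by (simp add: base_def pow_int_wreath_base)
  moreover have "(0, int e) \<in> H"
    using e(2)[of "(0, 1)"] by (simp add: pow_int_wreath_top)
  ultimately show ?thesis using e(1) that[of "int e"] by simp
qed

lemma pow_mem_H:
  assumes "(m, k) \<in> H"
  shows "\<exists>c. (c, k * s) \<in> H"
proof (induction s rule: int_induct[where k = 0])
  case base
  show ?case using H_zero by auto
next
  case (step1 s)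
  then obtain c where "(c, k * s) \<in> H" by blast
  then have "(c + T (k * s) * m, k * s + k) \<in> H" by (rule H_mult[OF _ assms])
  then show ?case by (auto simp: distrib_left)
next
  case (step2 s)
  then obtain c where "(c, k * s) \<in> H" by blast
  then have "(c + T (k * s) * (- T (- k) * m), k * s + - k) \<in> H" by (rule H_mult[OF _ H_inv[OF assms]])
  then show ?case by (auto simp: right_diff_distrib)
qed

section \<open>Separation modulo the ideals (1 - t^n, q)\<close>

lemma cong_set_UNIV_iff: "u \<in> cong_set k q UNIV \<longleftrightarrow> (\<exists>w. 1 - T k dvd u - of_int q * w)"
  unfolding cong_set_def dvd_def by (auto simp: algebra_simps)

lemma cong_set_UNIV_add:
  assumes "u \<in> cong_set k q UNIV" "v \<in> cong_set k q UNIV"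
  shows "u + v \<in> cong_set k q UNIV"
proof -
  obtain w w' where "1 - T k dvd u - of_int q * w" "1 - T k dvd v - of_int q * w'"
    using assms by (auto simp: cong_set_UNIV_iff)
  then have "1 - T k dvd (u - of_int q * w) + (v - of_int q * w')" by (rule dvd_add)
  then have "1 - T k dvd (u + v) - of_int q * (w + w')" by (simp add: algebra_simps)
  then show ?thesis unfolding cong_set_UNIV_iff by blast
qed

lemma cong_set_UNIV_mult:
  assumes "u \<in> cong_set k q UNIV"
  shows "v * u \<in> cong_set k q UNIV"
proof -
  obtain w where "1 - T k dvd u - of_int q * w"
    using assms by (auto simp: cong_set_UNIV_iff)
  then have "1 - T k dvd v * (u - of_int q * w)" by (rule dvd_mult)
  then have "1 - T k dvd v * u - of_int q * (v * w)" by (simp add: algebra_simps)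
  then show ?thesis unfolding cong_set_UNIV_iff by blast
qed

lemma cong_set_UNIV_diff: "u \<in> cong_set k q UNIV \<Longrightarrow> v \<in> cong_set k q UNIV \<Longrightarrow> u - v \<in> cong_set k q UNIV"
  using cong_set_UNIV_add[of u k q "- v"] cong_set_UNIV_mult[of v k q "- 1"] by simp

lemma cong_set_UNIV_dvd: "1 - T k dvd u \<Longrightarrow> u \<in> cong_set k q UNIV"
  unfolding cong_set_UNIV_iff by (rule exI[of _ 0]) simp

lemma cong_set_UNIV_of_int: "of_int q * u \<in> cong_set k q UNIV"
  unfolding cong_set_UNIV_iff by (rule exI[of _ u]) simp

text \<open>The subgroup consists of the \<open>(u, k)\<close> in \<open>H\<close> with
  \<open>u\<close> in the ideal (1 - t^n, q) and \<open>n\<close> dividing \<open>k\<close>. It is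
  normal since such t^k act trivially modulo the ideal, and \<open>q dvd d\<close> puts
  \<open>d\<close>\<Lambda> inside.\<close>

lemma separated_cong_set:
  assumes n: "n > 0" and q: "q > 0" "q dvd d"
    and sep: "\<And>x u k. x \<in> H \<Longrightarrow> n dvd k \<Longrightarrow> u \<in> cong_set n q UNIV \<Longrightarrow>
      x \<otimes>\<^bsub>\<W>\<^esub> f \<otimes>\<^bsub>\<W>\<^esub> inv\<^bsub>\<W>\<^esub> x \<otimes>\<^bsub>\<W>\<^esub> inv\<^bsub>\<W>\<^esub> g \<noteq> (u, k)"
  shows "separated f g"
proof -
  let ?I = "cong_set n q UNIV"
  have fi: "finite_index ?I" using n q by (intro finite_index_cong_set finite_index_UNIV) auto
  obtain c :: "laurent \<Rightarrow> laurent"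
    where c: "finite (range c)" "\<And>u v. c u = c v \<Longrightarrow> u - v \<in> ?I"
    by (rule finite_indexE[OF fi]) (use cong_set_UNIV_diff in blast, rule that)
  have T: "v - T k * v \<in> ?I" if "n dvd k" for k v
  proof -
    have "1 - T n dvd 1 - T k" using that one_minus_T_dvd by (elim dvdE) simp
    then show ?thesis by (intro cong_set_UNIV_dvd) (metis dvd_mult2 left_diff_distrib mult_1)
  qed
  show ?thesis
  proof (rule separatedI[of "{(u, k) \<in> H. u \<in> ?I \<and> n dvd k}" "\<lambda>(u, k). (c u, k mod n)"], goal_cases)
    case 1
    show ?case by auto
  next
    case (2 u)
    obtain d' where "d = q * d'" using q(2) by blast
    then have eq: "of_int d * u = of_int q * (of_int d' * u)" by (simp add: mult.assoc)
    have "of_int d * u \<in> ?I" unfolding eq by (rule cong_set_UNIV_of_int)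
    then show ?case using of_int_d_mult[of u] by simp
  next
    case (3 u k v l)
    then show ?case using H_mult[of u k v l] cong_set_UNIV_add[OF _ cong_set_UNIV_mult, of u n q v "T k"] by simp
  next
    case (4 u k)
    then show ?case using H_inv[of u k] cong_set_UNIV_mult[of u n q "- T (- k)"] by simp
  next
    case (5 c j u k)
    then have "T j * u + (c - T k * c) \<in> ?I"
      by (intro cong_set_UNIV_add cong_set_UNIV_mult T) auto
    then show ?case using 5 conj_mem_H[of c j u k] by (simp add: algebra_simps)
  next
    case 6
    have "range (\<lambda>(u, k). (c u, k mod n)) \<subseteq> range c \<times> {0..<n}" using n by auto
    then show ?case by (rule finite_subset) (use c(1) in simp)
  next
    case (7 u k v l)
    then have "n dvd k - l" by (simp add: mod_eq_dvd_iff)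
    then have "(u - v) + (v - T (k - l) * v) \<in> ?I"
      using 7 c(2) by (intro cong_set_UNIV_add T) auto
    then show ?case using 7 \<open>n dvd k - l\<close> by simp
  next
    case (8 x)
    then show ?case using sep by blast
  qed
qed

lemma separated_top_neq:
  assumes "k \<noteq> l"
  shows "separated (u, k) (v, l)"
\<comment> \<open>A modulus larger than \<open>\<bar>k - l\<bar>\<close> cannot divide the nonzero
  \<open>k - l\<close>. The coefficient modulus only has to be positive and to divide
  \<open>d\<close>.\<close>
proof (rule separated_cong_set[of "\<bar>k - l\<bar> + 1" "if d = 0 then 1 else d"])
  fix x w i assume "\<bar>k - l\<bar> + 1 dvd i"
  then have "i \<noteq> k - l" using assms zdvd_imp_le[of "\<bar>k - l\<bar> + 1" "\<bar>k - l\<bar>"] by auto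
  then show "x \<otimes>\<^bsub>\<W>\<^esub> (u, k) \<otimes>\<^bsub>\<W>\<^esub> inv\<^bsub>\<W>\<^esub> x \<otimes>\<^bsub>\<W>\<^esub> inv\<^bsub>\<W>\<^esub> (v, l) \<noteq> (w, i)"
    by (cases x) (auto simp only: conj_mult_inv_int_wreath prod.inject)
qed (use d_nonneg in auto)

text \<open>If t^j m and m' agree modulo (1 - t^n, q), then \<open>j\<close> can be changed by a
  multiple of \<open>n\<close> to some \<open>r\<close> for which both supports lie in one window of
  length \<open>n\<close>. Then t^r m and m' agree modulo \<open>d\<close>, and \<open>r\<close>
  still occurs as a top coordinate in \<open>H\<close>, against the hypothesis.\<close>

lemma separated_base:
  assumes nc: "\<And>x u. x \<in> H \<Longrightarrow>
    x \<otimes>\<^bsub>\<W>\<^esub> (m, 0) \<otimes>\<^bsub>\<W>\<^esub> inv\<^bsub>\<W>\<^esub> x \<otimes>\<^bsub>\<W>\<^esub> inv\<^bsub>\<W>\<^esub> (m', 0) \<noteq> (of_int d * u, 0)"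
  shows "separated (m, 0) (m', 0)"
proof -
  obtain e where e: "e > 0" "(0, e) \<in> H" using exponent by blast
  obtain D where D: "0 \<le> D" "supp m \<subseteq> {- D..D}" "supp m' \<subseteq> {- D..D}"
    using support_bound .
  obtain Q where Q: "0 < Q" "\<And>i. \<bar>coef m i\<bar> < Q" using coefficient_bound[of m] by blast
  obtain Q' where Q': "0 < Q'" "\<And>i. \<bar>coef m' i\<bar> < Q'" using coefficient_bound[of m'] by blast
  \<comment> \<open>The factor \<open>e\<close> keeps exponents congruent to \<open>j\<close> modulo
    \<open>n\<close> available in \<open>H\<close>; the factor \<open>4 * D + 1\<close> makes room
    for both supports.\<close>
  define n where "n = e * (4 * D + 1)"
  have n: "4 * D + 1 \<le> n" using e(1) D(1) mult_right_mono[of 1 e "4 * D + 1"] by (simp add: n_def)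
  \<comment> \<open>For \<open>d = 0\<close> this bounds the coefficients of every t^r m - m', so
    divisibility by \<open>q\<close> means equality.\<close>
  define q where "q = (if d = 0 then Q + Q' else d)"
  show ?thesis
  proof (rule separated_cong_set[of n q], goal_cases)
    case (4 x u k)
    obtain c j where x: "x = (c, j)" by (cases x)
    show ?case
    proof
      assume "x \<otimes>\<^bsub>\<W>\<^esub> (m, 0) \<otimes>\<^bsub>\<W>\<^esub> inv\<^bsub>\<W>\<^esub> x \<otimes>\<^bsub>\<W>\<^esub> inv\<^bsub>\<W>\<^esub> (m', 0) = (u, k)"
      then have "u = T j * m - m'" unfolding x conj_mult_inv_int_wreath by simp
      then obtain w where w: "1 - T n dvd (T j * m - m') - of_int q * w"
        using 4(3) cong_set_UNIV_iff by auto
      define t where "t = j mod n"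
      have t: "0 \<le> t" "t < n" using n D(1) by (auto simp: t_def)
      \<comment> \<open>This is the representative of \<open>j\<close> modulo \<open>n\<close> with
        \<open>- 2 * D \<le> r\<close> and \<open>r < n - 2 * D\<close>. The window of length
        \<open>n\<close> starting at \<open>a\<close> below holds both supports; in the second case
        this uses the full \<open>4 * D + 1\<close>.\<close>
      define r where "r = (if t < n - 2 * D then t else t - n)"
      have r: "n dvd j - r"
        by (simp add: r_def t_def minus_mod_eq_mult_div mod_eq_dvd_iff[symmetric])
      define a where "a = (if t < n - 2 * D then - D else - 3 * D)"
      have "supp (T r * m - m') \<subseteq> {a..<a + \<bar>n\<bar>}"
      proof (intro subsetI)
        fix i assume "i \<in> supp (T r * m - m')"
        then have "i - r \<in> supp m \<or> i \<in> supp m'"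
          by (auto simp: in_keys_iff lookup_minus lookup_single_mult)
        then have "i - r \<in> {- D..D} \<or> i \<in> {- D..D}" using D by blast
        with t show "i \<in> {a..<a + \<bar>n\<bar>}"
          using n D(1) unfolding r_def a_def by (auto split: if_splits)
      qed
      moreover have "1 - T n dvd (T r * m - m') - of_int q * w"
      proof -
        have "1 - T n dvd ((T j * m - m') - of_int q * w) - (T j - T r) * m"
          by (rule dvd_diff[OF w dvd_mult2[OF T_cong[OF r]]])
        then show ?thesis by (simp add: algebra_simps)
      qed
      ultimately have q: "of_int q dvd T r * m - m'"
        using n D(1) of_int_dvd_if_short[of n "T r * m - m'" q w a] by simp
      have "of_int d dvd T r * m - m'"
      proof (cases "d = 0")
        case True
        have "\<bar>coef (T r * m - m') i\<bar> < q" for i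
          using Q(2)[of "i - r"] Q'(2)[of i] True
          by (simp add: q_def lookup_minus lookup_single_mult)
        then have "T r * m - m' = 0" using of_int_dvd_small_imp_0[OF q] by blast
        then show ?thesis by simp
      next
        case False
        then show ?thesis using q by (simp add: q_def)
      qed
      then obtain v where v: "T r * m - m' = of_int d * v" by (rule dvdE)
      have "e dvd r - j" using r unfolding n_def by (metis dvd_minus_iff dvd_mult_left minus_diff_eq)
      then obtain s where s: "r = j + e * s" by (metis dvdE add.commute diff_add_cancel)
      obtain c' where "(c', e * s) \<in> H" using pow_mem_H[OF e(2)] by blast
      then have "(c + T j * c', r) \<in> H" using H_mult 4(1) unfolding x s by blast
      then show False using nc[of "(c + T j * c', r)" v] v
        unfolding conj_mult_inv_int_wreath by simp
    qed
  qed (use n D(1) Q Q' d_nonneg in \<open>auto simp: q_def\<close>)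
qed

lemma base_T_mult_pow: "(m, k) \<in> H \<Longrightarrow> u \<in> base \<Longrightarrow> T (k * s) * u \<in> base"
  using pow_mem_H base_T_mult by blast

text \<open>For \<open>s \<ge> 0\<close>, \<open>geom k s\<close> is a sum of \<open>s\<close>
  powers of t^k, each acting as 1 modulo 1 - t^k. The induction shows that the error is 1 - t^k
  times an element of the base, not just of \<Lambda>.\<close>

lemma geom_mult_base:
  assumes k: "k \<noteq> 0" "(m, k) \<in> H" and u: "u \<in> base"
  shows "\<exists>b\<in>base. geom k s * u = of_int s * u + (1 - T k) * b"
proof -
  have T: "T (k * s) * u = u - (1 - T k) * (geom k s * u)" for s
    unfolding mult.assoc[symmetric] geom by (simp add: left_diff_distrib)
  have mem: "geom k s * u \<in> base" if b: "b \<in> base" "geom k s * u = of_int s * u + (1 - T k) * b" for b s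
  proof -
    have "(1 - T k) * b \<in> base"
      using base_T_mult[OF k(2) b(1)] b(1) base_diff by (simp add: left_diff_distrib)
    then show ?thesis unfolding b(2) by (intro base_add base_of_int_mult u)
  qed
  show ?thesis
  proof (induction s rule: int_induct[where k = 0])
    case base
    show ?case using base_zero k by (intro bexI[of _ 0]) (simp_all add: geom_0)
  next
    case (step1 s)
    then obtain b where b: "b \<in> base" "geom k s * u = of_int s * u + (1 - T k) * b" by blast
    have "geom k (s + 1) * u = geom k s * u + T (k * s) * u"
      using geom_add[OF k(1), of s 1] k(1) by (simp add: geom_1 algebra_simps)
    also have "\<dots> = of_int (s + 1) * u + (1 - T k) * (b - geom k s * u)"
      unfolding T b(2) by (simp add: algebra_simps)
    finally show ?case using base_diff[OF b(1) mem[OF b]] by blast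
  next
    case (step2 s)
    then obtain b where b: "b \<in> base" "geom k s * u = of_int s * u + (1 - T k) * b" by blast
    have s: "geom k s = geom k (s - 1) + T (k * (s - 1))"
      using geom_add[OF k(1), of "s - 1" 1] k(1) by (simp add: geom_1)
    then have eq: "geom k (s - 1) * u = geom k s * u - T (k * (s - 1)) * u"
      by (simp add: algebra_simps)
    then have "geom k (s - 1) * u \<in> base"
      using base_diff[OF mem[OF b] base_T_mult_pow[OF k(2) u, of "s - 1"]] by simp
    moreover have "geom k (s - 1) * u = of_int (s - 1) * u + (1 - T k) * (b + geom k (s - 1) * u)"
      using eq unfolding T b(2) by (simp add: algebra_simps)
    ultimately show ?case using base_add[OF b(1)] by blast
  qed
qed

end

section \<open>Elements with nonzero top coordinate\<close>

locale top_nonzero = finite_index_subgroup +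
  fixes m :: laurent and k q :: int
  assumes f: "(m, k) \<in> H" and k: "k \<noteq> 0" and q: "q > 0"
begin

text \<open>With \<open>b\<close> in the base, the term (1 - t^k) b can be absorbed by replacing a
  conjugator \<open>(c, j)\<close> by \<open>(c - b, j)\<close>, which is again in
  \<open>H\<close>.\<close>

definition N :: "laurent set"
  where "N = {(1 - T k) * b + of_int q * c + of_int d * z | b c z. b \<in> base \<and> c \<in> base}"

lemma NI: "b \<in> base \<Longrightarrow> c \<in> base \<Longrightarrow> (1 - T k) * b + of_int q * c + of_int d * z \<in> N"
  unfolding N_def by blast

lemma NE:
  assumes "u \<in> N"
  obtains b c z where "b \<in> base" "c \<in> base" "u = (1 - T k) * b + of_int q * c + of_int d * z"
  using assms unfolding N_def by (elim CollectE exE conjE) (rule that)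

lemma N_add:
  assumes "u \<in> N" "v \<in> N"
  shows "u + v \<in> N"
proof -
  obtain b c z where u: "b \<in> base" "c \<in> base" "u = (1 - T k) * b + of_int q * c + of_int d * z"
    using assms(1) by (rule NE)
  obtain b' c' z' where v: "b' \<in> base" "c' \<in> base" "v = (1 - T k) * b' + of_int q * c' + of_int d * z'"
    using assms(2) by (rule NE)
  show ?thesis
    using NI[OF base_add[OF u(1) v(1)] base_add[OF u(2) v(2)], of "z + z'"]
    unfolding u(3) v(3) by (simp add: algebra_simps)
qed

lemma N_uminus:
  assumes "u \<in> N"
  shows "- u \<in> N"
proof -
  obtain b c z where u: "b \<in> base" "c \<in> base" "u = (1 - T k) * b + of_int q * c + of_int d * z"
    using assms by (rule NE)
  show ?thesis
    using NI[OF base_uminus[OF u(1)] base_uminus[OF u(2)], of "- z"]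
    unfolding u(3) by (simp add: algebra_simps)
qed

lemma N_diff: "u \<in> N \<Longrightarrow> v \<in> N \<Longrightarrow> u - v \<in> N"
  using N_add[of u "- v"] N_uminus[of v] by simp

lemma N_T_mult:
  assumes "u \<in> N" "(c, j) \<in> H"
  shows "T j * u \<in> N"
proof -
  obtain a b z where u: "a \<in> base" "b \<in> base" "u = (1 - T k) * a + of_int q * b + of_int d * z"
    using assms(1) by (rule NE)
  show ?thesis
    using NI[OF base_T_mult[OF assms(2) u(1)] base_T_mult[OF assms(2) u(2)], of "T j * z"]
    unfolding u(3) by (simp add: algebra_simps)
qed

lemma N_T_mult_pow: "u \<in> N \<Longrightarrow> T (k * s) * u \<in> N"
  using pow_mem_H[OF f] N_T_mult by blast

lemma finite_index_N: "finite_index N"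
proof (rule finite_index_mono)
  show "finite_index (cong_set k q base)"
    using k q finite_index_base by (rule finite_index_cong_set)
  show "cong_set k q base \<subseteq> N"
    unfolding cong_set_def using NI[of _ _ 0] by auto
qed

text \<open>With f = (m, k), a conjugate of f by an element of \<open>H\<close> is (D, 0) f with
  \<open>D\<close> in the base. Its power with exponent q i differs from that of f by
  \<open>geom k (q * i) * D\<close>, which is q i D modulo (1 - t^k) times the base, hence lies in
  \<open>N\<close>. So \<open>L\<close> is normal; its elements with top coordinate 0 come from
  \<open>N\<close>, which gives the separation.\<close>

lemma separated_top_eq:
  assumes nc: "\<And>c j. (c, j) \<in> H \<Longrightarrow> c + T j * m - T k * c - m' \<notin> N"
  shows "separated (m, k) (m', k)"
proof -
  obtain cl :: "laurent \<Rightarrow> laurent"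
    where cl: "finite (range cl)" "\<And>u v. cl u = cl v \<Longrightarrow> u - v \<in> N"
    by (rule finite_indexE[OF finite_index_N]) (use N_diff in blast, rule that)
  define p where "p = q * k"
  have p: "p \<noteq> 0" using k q by (simp add: p_def)
  have kp: "k * (q * i) = p * i" for i by (simp add: p_def)
  have Tp: "T (p * i) * u \<in> N" if "u \<in> N" for i u
    using N_T_mult_pow[OF that, of "q * i"] by (simp only: kp)
  have add: "geom k (q * (i + j)) = geom k (q * i) + T (p * i) * geom k (q * j)" for i j
    using geom_add[OF k, of "q * i" "q * j"] by (simp add: distrib_left kp)
  txt \<open>\<open>L\<close> is the subgroup generated by \<open>N\<close> and \<open>(m, k)\<^sup>q\<close>.\<close>
  define L where "L = {(u, l) \<in> H. \<exists>i. l = p * i \<and> u - geom k (q * i) * m \<in> N}"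
  have LI: "(u, p * i) \<in> L" if "(u, p * i) \<in> H" "u - geom k (q * i) * m \<in> N" for u i
    using that by (auto simp: L_def)
  have LE: "\<exists>i. l = p * i \<and> u - geom k (q * i) * m \<in> N \<and> (u, l) \<in> H" if "(u, l) \<in> L" for u l
    using that by (auto simp: L_def)
  \<comment> \<open>These are the coordinates of f^(- q a) (u, l) for a = \<open>l div p\<close>,
    the first one taken modulo \<open>N\<close> by means of \<open>cl\<close>.\<close>
  let ?c = "\<lambda>(u, l). (cl (T (- (p * (l div p))) * (u - geom k (q * (l div p)) * m)), l mod p)"
  show ?thesis
  proof (rule separatedI[of L ?c], goal_cases)
    case 1
    show ?case by (auto simp: L_def)
  next
    case (2 u)
    show ?case
      using LI[of "of_int d * u" 0] NI[OF base_zero base_zero, of u] of_int_d_mult[of u] k by (simp add: geom_0)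
  next
    case (3 u l v l')
    obtain i where i: "l = p * i" "u - geom k (q * i) * m \<in> N" "(u, l) \<in> H" using LE[OF 3(1)] by blast
    obtain j where j: "l' = p * j" "v - geom k (q * j) * m \<in> N" "(v, l') \<in> H" using LE[OF 3(2)] by blast
    have "(u + T l * v, p * (i + j)) \<in> L"
    proof (rule LI)
      show "(u + T l * v, p * (i + j)) \<in> H" using H_mult[OF i(3) j(3)] by (simp add: i(1) j(1) distrib_left)
      have "(u - geom k (q * i) * m) + T (p * i) * (v - geom k (q * j) * m) \<in> N"
        using i j Tp N_add by blast
      then show "u + T l * v - geom k (q * (i + j)) * m \<in> N"
        unfolding add i(1) by (simp add: algebra_simps)
    qed
    then show ?case by (simp add: i(1) j(1) distrib_left)
  next
    case (4 u l)
    obtain i where i: "l = p * i" "u - geom k (q * i) * m \<in> N" "(u, l) \<in> H" using LE[OF 4] by blast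
    have "(- T (- l) * u, p * - i) \<in> L"
    proof (rule LI)
      show "(- T (- l) * u, p * - i) \<in> H" using H_inv[OF i(3)] by (simp add: i(1))
      have "geom k (q * - i) = - T (p * - i) * geom k (q * i)"
        using add[of "- i" i] k by (simp add: geom_0 eq_neg_iff_add_eq_0)
      moreover have "- (T (p * - i) * (u - geom k (q * i) * m)) \<in> N"
        using i Tp N_uminus by blast
      ultimately show "- T (- l) * u - geom k (q * - i) * m \<in> N"
        unfolding i(1) by (simp add: algebra_simps)
    qed
    then show ?case by (simp add: i(1))
  next
    case (5 c j u l)
    obtain i where i: "l = p * i" "u - geom k (q * i) * m \<in> N" "(u, l) \<in> H" using LE[OF 5(2)] by blast
    \<comment> \<open>\<open>(D, 0)\<close> is the commutator of \<open>(c, j)\<close> and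
      f.\<close>
    define D where "D = c + T j * m - T k * c - m"
    have "(D, 0) \<in> H"
      using H_mult[OF conj_mem_H[OF 5(1) f] H_inv[OF f]]
      by (simp add: D_def algebra_simps T_mult T_mult_left)
    then have D: "D \<in> base" by (simp add: base_def)
    obtain b where b: "b \<in> base" "geom k (q * i) * D = of_int (q * i) * D + (1 - T k) * b"
      using geom_mult_base[OF k f D] by blast
    have "(1 - T k) * b + of_int q * (of_int i * D) + of_int d * 0 \<in> N"
      by (intro NI b base_of_int_mult D)
    then have "geom k (q * i) * D \<in> N" unfolding b(2) by (simp add: algebra_simps)
    then have "T j * (u - geom k (q * i) * m) + geom k (q * i) * D \<in> N"
      using N_T_mult[OF i(2) 5(1)] N_add by blast
    moreover have "geom k (q * i) * D = c - T (p * i) * c + geom k (q * i) * (T j * m - m)"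
      using arg_cong[OF geom[of k "q * i"], of "\<lambda>w. w * c"]
      unfolding kp D_def by (simp add: algebra_simps)
    ultimately have "T j * (u - geom k (q * i) * m) +
        (c - T (p * i) * c + geom k (q * i) * (T j * m - m)) \<in> N"
      by (simp only:)
    then have "c + T j * u - T l * c - geom k (q * i) * m \<in> N"
      unfolding i(1) by (simp add: algebra_simps)
    then show ?case using LI conj_mem_H[OF 5(1) i(3)] i(1) by simp
  next
    case 6
    \<comment> \<open>The interval is symmetric because \<open>p\<close> has the sign of
      \<open>k\<close>, and \<open>l mod p\<close> has the sign of \<open>p\<close>.\<close>
    have "range ?c \<subseteq> range cl \<times> {- \<bar>p\<bar>..\<bar>p\<bar>}"
      using abs_mod_less[OF p] by (auto simp: abs_le_iff) (smt (verit))+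
    then show ?case by (rule finite_subset) (use cl(1) in simp)
  next
    case (7 u l v l')
    define a a' where "a = l div p" and "a' = l' div p"
    have eq: "cl (T (- (p * a)) * (u - geom k (q * a) * m)) = cl (T (- (p * a')) * (v - geom k (q * a') * m))"
      "l mod p = l' mod p"
      using 7(3) by (simp_all add: a_def a'_def)
    have l: "l - l' = p * (a - a')"
      using eq(2) minus_mod_eq_mult_div[of l p] minus_mod_eq_mult_div[of l' p]
      unfolding a_def a'_def right_diff_distrib by linarith
    have "T (p * a) * (T (- (p * a)) * (u - geom k (q * a) * m) -
      T (- (p * a')) * (v - geom k (q * a') * m)) \<in> N"
      using cl(2)[OF eq(1)] Tp by blast
    then have "u - geom k (q * a) * m - T (p * (a - a')) * (v - geom k (q * a') * m) \<in> N"
      by (simp add: right_diff_distrib T_mult_left)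
    moreover have "geom k (q * a) = geom k (q * (a - a')) + T (p * (a - a')) * geom k (q * a')"
      using add[of "a - a'" a'] by simp
    ultimately have "u - T (l - l') * v - geom k (q * (a - a')) * m \<in> N"
      unfolding l by (simp add: algebra_simps)
    then show ?case using LI[of _ "a - a'"] 7(4) unfolding l by blast
  next
    case (8 x)
    obtain c j where x: "x = (c, j)" by (cases x)
    show ?case
    proof
      assume "x \<otimes>\<^bsub>\<W>\<^esub> (m, k) \<otimes>\<^bsub>\<W>\<^esub> inv\<^bsub>\<W>\<^esub> x \<otimes>\<^bsub>\<W>\<^esub> inv\<^bsub>\<W>\<^esub> (m', k) \<in> L"
      then have "(c + T j * m - T k * c - m', 0) \<in> L"
        unfolding x conj_mult_inv_int_wreath by simp
      then have "c + T j * m - T k * c - m' \<in> N"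
        using LE p k by (fastforce simp: geom_0)
      then show False using nc 8 x by blast
    qed
  qed
qed

end

context finite_index_subgroup
begin

text \<open>For \<open>d \<noteq> 0\<close> take \<open>q = d\<close>, so that \<open>N\<close> is
  (1 - t^k) times the base plus \<open>d\<close>\<Lambda>. For \<open>d = 0\<close> a large
  \<open>q\<close> turns agreement modulo (1 - t^k, q) into agreement modulo 1 - t^k. Torsion
  freeness then makes the term q y a multiple of (1 - t^k) q, and it is absorbed by the conjugator
  because \<open>e\<close> divides \<open>q\<close>.\<close>

lemma separated_top_nonzero:
  assumes f: "(m, k) \<in> H" and k: "k \<noteq> 0"
    and nc: "\<And>c j u. (c, j) \<in> H \<Longrightarrow> c + T j * m - T k * c - m' \<noteq> of_int d * u"
  shows "separated (m, k) (m', k)"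
proof -
  have sub: "(c - b, j) \<in> H" if "(c, j) \<in> H" "b \<in> base" for b c j
    using H_mult[of "- b" 0 c j] base_uminus[OF that(2)] that(1) by (simp add: base_def)
  have shift: "(c - b) + T j * m - T k * (c - b) - m' = w"
    if "c + T j * m - T k * c - m' = (1 - T k) * b + w" for b c j w
    using that by (simp add: algebra_simps)
  show ?thesis
  proof (cases "d = 0")
    case False
    then interpret top_nonzero H d m k d
      using f k d_nonneg by unfold_locales auto
    show ?thesis
    proof (rule separated_top_eq, rule notI)
      fix c j assume cj: "(c, j) \<in> H" and "c + T j * m - T k * c - m' \<in> N"
      then obtain b y z where b: "b \<in> base"
        and eq: "c + T j * m - T k * c - m' = (1 - T k) * b + of_int d * y + of_int d * z"
        by (elim NE)
      have "(c - b) + T j * m - T k * (c - b) - m' = of_int d * (y + z)"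
        by (rule shift) (simp add: eq distrib_left)
      then show False using nc sub[OF cj b] by blast
    qed
  next
    case True
    obtain e where e: "e > 0" "\<And>u. of_int e * u \<in> base" using exponent by blast
    \<comment> \<open>The bound depends on the exponent \<open>r\<close>, but modulo 1 - t^k only
      the \<open>r\<close> in \<open>{0..<\<bar>k\<bar>}\<close> matter.\<close>
    have "\<exists>Q. \<forall>r. 0 < Q r \<and> (\<forall>q w. q \<ge> Q r \<longrightarrow>
      1 - T k dvd (T r * m - m') - of_int q * w \<longrightarrow> 1 - T k dvd T r * m - m')"
    proof (rule choice, rule allI)
      fix r
      obtain Q where "0 < Q"
        "\<And>q w. q \<ge> Q \<Longrightarrow> 1 - T k dvd (T r * m - m') - of_int q * w \<Longrightarrow> 1 - T k dvd T r * m - m'"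
        by (rule one_minus_T_dvd_if_dvd_mod[OF k]) (rule that)
      then show "\<exists>Q. 0 < Q \<and> (\<forall>q w. q \<ge> Q \<longrightarrow>
        1 - T k dvd (T r * m - m') - of_int q * w \<longrightarrow> 1 - T k dvd T r * m - m')" by auto
    qed
    then obtain Q :: "int \<Rightarrow> int" where Q: "\<And>r. 0 < Q r" "\<And>r q w. q \<ge> Q r \<Longrightarrow>
      1 - T k dvd (T r * m - m') - of_int q * w \<Longrightarrow> 1 - T k dvd T r * m - m'" by metis
    \<comment> \<open>The sum dominates each of the finitely many bounds, and the factor
      \<open>e\<close> puts all multiples of \<open>q\<close> into the base.\<close>
    define q where "q = e * (1 + sum Q {0..<\<bar>k\<bar>})"
    have sum_pos: "0 \<le> sum Q {0..<\<bar>k\<bar>}" using Q(1) by (intro sum_nonneg) (simp add: less_imp_le)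
    then have q: "q > 0" using e(1) by (simp add: q_def)
    have qQ: "Q r \<le> q" if "r \<in> {0..<\<bar>k\<bar>}" for r
    proof -
      have "Q r \<le> sum Q {0..<\<bar>k\<bar>}" using that Q(1) by (intro member_le_sum) (auto simp: less_imp_le)
      also have "\<dots> \<le> 1 * (1 + sum Q {0..<\<bar>k\<bar>})" by simp
      also have "\<dots> \<le> q" unfolding q_def using e(1) sum_pos by (intro mult_right_mono) simp_all
      finally show ?thesis .
    qed
    interpret top_nonzero H d m k q
      using f k q by unfold_locales auto
    show ?thesis
    proof (rule separated_top_eq, rule notI)
      fix c j assume cj: "(c, j) \<in> H" and "c + T j * m - T k * c - m' \<in> N"
      then obtain b y z where b: "b \<in> base" and y: "y \<in> base"
        and "c + T j * m - T k * c - m' = (1 - T k) * b + of_int q * y + of_int d * z"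
        by (elim NE)
      then have eq: "c + T j * m - T k * c - m' = (1 - T k) * b + of_int q * y" using True by simp
      define r where "r = j mod \<bar>k\<bar>"
      have "r \<in> {0..<\<bar>k\<bar>}" using k by (simp add: r_def)
      have Tr: "1 - T k dvd (T j - T r) * m"
        unfolding r_def by (intro dvd_mult2 T_cong_mod)
      have Tj: "T j * m - m' - of_int q * y = (1 - T k) * (b - c)"
        using eq by (simp add: algebra_simps)
      then have "1 - T k dvd T j * m - m' - of_int q * y" by (rule dvdI)
      then have "1 - T k dvd (T j * m - m' - of_int q * y) - (T j - T r) * m"
        using Tr by (rule dvd_diff)
      then have "1 - T k dvd (T r * m - m') - of_int q * y" by (simp add: algebra_simps)
      then have "1 - T k dvd T r * m - m'" using Q(2) qQ[OF \<open>r \<in> _\<close>] by blast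
      then have "1 - T k dvd (T r * m - m') + (T j - T r) * m" using Tr by (rule dvd_add)
      then have "1 - T k dvd T j * m - m'" by (simp add: algebra_simps)
      then have "1 - T k dvd (T j * m - m') - (1 - T k) * (b - c)"
        by (rule dvd_diff) simp
      then have "1 - T k dvd of_int q * y" unfolding Tj[symmetric] by simp
      then have "1 - T k dvd y" using one_minus_T_dvd_of_int_mult[OF k, of q y] q by simp
      then obtain z where z: "y = (1 - T k) * z" by (rule dvdE)
      have "of_int q * z \<in> base"
        using e(2)[of "of_int (1 + sum Q {0..<\<bar>k\<bar>}) * z"] by (simp add: q_def mult.assoc)
      then have "b + of_int q * z \<in> base" by (rule base_add[OF b])
      moreover have "(c - (b + of_int q * z)) + T j * m - T k * (c - (b + of_int q * z)) - m' = of_int d * 0"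
        by (rule shift, unfold eq z) (simp add: algebra_simps)
      ultimately show False using nc sub[OF cj] by blast
    qed
  qed
qed

lemma separated_if_not_conjugate_mod:
  assumes f: "f \<in> H"
    and nc: "\<And>x u. x \<in> H \<Longrightarrow>
      x \<otimes>\<^bsub>\<W>\<^esub> f \<otimes>\<^bsub>\<W>\<^esub> inv\<^bsub>\<W>\<^esub> x \<otimes>\<^bsub>\<W>\<^esub> inv\<^bsub>\<W>\<^esub> g \<noteq> (of_int d * u, 0)"
  shows "separated f g"
proof -
  obtain m k where fm: "f = (m, k)" by (cases f)
  obtain m' l where gm: "g = (m', l)" by (cases g)
  consider "k \<noteq> l" | "k = l" "k = 0" | "k = l" "k \<noteq> 0" by blast
  then show ?thesis
  proof cases
    case 1
    then show ?thesis using separated_top_neq fm gm by simp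
  next
    case 2
    then show ?thesis using separated_base[of m m'] nc unfolding fm gm by simp
  next
    case 3
    have "c + T j * m - T k * c - m' \<noteq> of_int d * u" if "(c, j) \<in> H" for c j u
      using nc[OF that, of u] unfolding fm gm conj_mult_inv_int_wreath using 3(1) by simp
    then show ?thesis using separated_top_nonzero[of m k m'] f 3 unfolding fm gm by simp
  qed
qed

end

section \<open>Wreath products of cyclic groups with the integers\<close>

text \<open>A normal subgroup \<open>L\<close> of \<open>A\<close> above the kernel yields the
  finite quotient of \<open>B\<close> by the image of \<open>L\<close>. Membership in the kernel
  expresses conjugacy in \<open>B\<close>, membership in \<open>L\<close> conjugacy in that
  quotient.\<close>

lemma conjugacy_separable_epi:
  assumes "group A" "group B" and \<phi>: "\<phi> \<in> epi A B"
    and sep: "\<And>f g. f \<in> carrier A \<Longrightarrow> g \<in> carrier A \<Longrightarrow>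
      (\<And>x. x \<in> carrier A \<Longrightarrow> x \<otimes>\<^bsub>A\<^esub> f \<otimes>\<^bsub>A\<^esub> inv\<^bsub>A\<^esub> x \<otimes>\<^bsub>A\<^esub> inv\<^bsub>A\<^esub> g \<notin> kernel A B \<phi>) \<Longrightarrow>
      \<exists>L. L \<lhd> A \<and> finite (rcosets\<^bsub>A\<^esub> L) \<and> kernel A B \<phi> \<subseteq> L \<and>
        (\<forall>x\<in>carrier A. x \<otimes>\<^bsub>A\<^esub> f \<otimes>\<^bsub>A\<^esub> inv\<^bsub>A\<^esub> x \<otimes>\<^bsub>A\<^esub> inv\<^bsub>A\<^esub> g \<notin> L)"
  shows "conjugacy_separable B"
  unfolding conjugacy_separable_def
proof (intro ballI impI)
  interpret A: group A by fact
  interpret B: group B by fact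
  interpret \<phi>: group_hom A B \<phi> using \<phi> by unfold_locales (simp add: epi_def)
  have surj: "\<phi> ` carrier A = carrier B" using \<phi> by (simp add: epi_def)
  fix f' g' assume f': "f' \<in> carrier B" and g': "g' \<in> carrier B" and nc: "\<not> conjugate B f' g'"
  obtain f g where f: "f \<in> carrier A" "f' = \<phi> f" and g: "g \<in> carrier A" "g' = \<phi> g"
    using f' g' surj by (metis imageE)
  have "x \<otimes>\<^bsub>A\<^esub> f \<otimes>\<^bsub>A\<^esub> inv\<^bsub>A\<^esub> x \<otimes>\<^bsub>A\<^esub> inv\<^bsub>A\<^esub> g \<notin> kernel A B \<phi>" if x: "x \<in> carrier A" for x
  proof
    assume "x \<otimes>\<^bsub>A\<^esub> f \<otimes>\<^bsub>A\<^esub> inv\<^bsub>A\<^esub> x \<otimes>\<^bsub>A\<^esub> inv\<^bsub>A\<^esub> g \<in> kernel A B \<phi>"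
    then have "\<phi> x \<otimes>\<^bsub>B\<^esub> f' \<otimes>\<^bsub>B\<^esub> inv\<^bsub>B\<^esub> \<phi> x \<otimes>\<^bsub>B\<^esub> inv\<^bsub>B\<^esub> g' = \<one>\<^bsub>B\<^esub>"
      using x f g by (simp add: kernel_def)
    then have "g' = \<phi> x \<otimes>\<^bsub>B\<^esub> f' \<otimes>\<^bsub>B\<^esub> inv\<^bsub>B\<^esub> \<phi> x"
      using x f g B.inv_solve_right'[of "\<one>\<^bsub>B\<^esub>" "\<phi> x \<otimes>\<^bsub>B\<^esub> f' \<otimes>\<^bsub>B\<^esub> inv\<^bsub>B\<^esub> \<phi> x" g'] by simp
    then show False using nc x unfolding conjugate_def by auto
  qed
  then obtain L where L: "L \<lhd> A" "finite (rcosets\<^bsub>A\<^esub> L)" "kernel A B \<phi> \<subseteq> L"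
    "\<And>x. x \<in> carrier A \<Longrightarrow> x \<otimes>\<^bsub>A\<^esub> f \<otimes>\<^bsub>A\<^esub> inv\<^bsub>A\<^esub> x \<otimes>\<^bsub>A\<^esub> inv\<^bsub>A\<^esub> g \<notin> L"
    using sep[OF f(1) g(1)] by blast
  interpret L: normal L A by fact
  have N: "\<phi> ` L \<lhd> B"
    using L.surj_hom_normal_subgroup[OF \<phi>.group_hom_axioms surj] .
  interpret N: normal "\<phi> ` L" B by fact
  define Q where "Q = B Mod \<phi> ` L"
  have coset: "\<phi> ` L #>\<^bsub>B\<^esub> \<phi> x = \<phi> ` (L #>\<^bsub>A\<^esub> x)" if "x \<in> carrier A" for x
    using that L.subset unfolding r_coset_def by (fastforce simp: image_iff)
  have "carrier Q \<subseteq> (`) \<phi> ` (rcosets\<^bsub>A\<^esub> L)"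
    unfolding Q_def carrier_FactGroup surj[symmetric] using coset by (auto simp: RCOSETS_def)
  then have Q: "finite_group Q"
    unfolding finite_group_def using L(2) N.factorgroup_is_group finite_surj by (auto simp: Q_def)
  let ?\<pi> = "\<lambda>x. \<phi> ` L #>\<^bsub>B\<^esub> x"
  have hom: "?\<pi> \<in> hom B Q" unfolding Q_def by (rule N.r_coset_hom_Mod)
  then have \<pi>: "?\<pi> \<in> epi B Q" by (auto simp: epi_def Q_def carrier_FactGroup)
  interpret \<pi>: group_hom B Q ?\<pi>
    using Q by (intro group_hom.intro group_hom_axioms.intro hom B.is_group) (simp add: finite_group_def)
  have "\<not> conjugate Q (?\<pi> f') (?\<pi> g')"
  proof
    assume "conjugate Q (?\<pi> f') (?\<pi> g')"
    then obtain X where X: "X \<in> carrier Q" "?\<pi> g' = X \<otimes>\<^bsub>Q\<^esub> ?\<pi> f' \<otimes>\<^bsub>Q\<^esub> inv\<^bsub>Q\<^esub> X"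
      unfolding conjugate_def by blast
    have "X \<in> ?\<pi> ` \<phi> ` carrier A" using X(1) \<pi> unfolding surj by (simp add: epi_def)
    then obtain x where x: "x \<in> carrier A" "?\<pi> g' = ?\<pi> (\<phi> x) \<otimes>\<^bsub>Q\<^esub> ?\<pi> f' \<otimes>\<^bsub>Q\<^esub> inv\<^bsub>Q\<^esub> ?\<pi> (\<phi> x)"
      using X(2) by (elim imageE) simp
    then have "?\<pi> g' = ?\<pi> (\<phi> x \<otimes>\<^bsub>B\<^esub> f' \<otimes>\<^bsub>B\<^esub> inv\<^bsub>B\<^esub> \<phi> x)"
      using f' by simp
    moreover have "\<phi> x \<otimes>\<^bsub>B\<^esub> f' \<otimes>\<^bsub>B\<^esub> inv\<^bsub>B\<^esub> \<phi> x \<in> ?\<pi> (\<phi> x \<otimes>\<^bsub>B\<^esub> f' \<otimes>\<^bsub>B\<^esub> inv\<^bsub>B\<^esub> \<phi> x)"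
      using x f' by (intro B.rcos_self N.subgroup_axioms) auto
    ultimately have mem: "\<phi> x \<otimes>\<^bsub>B\<^esub> f' \<otimes>\<^bsub>B\<^esub> inv\<^bsub>B\<^esub> \<phi> x \<in> ?\<pi> g'" by simp
    have "\<phi> x \<otimes>\<^bsub>B\<^esub> f' \<otimes>\<^bsub>B\<^esub> inv\<^bsub>B\<^esub> \<phi> x \<otimes>\<^bsub>B\<^esub> inv\<^bsub>B\<^esub> g' \<in> \<phi> ` L"
      by (rule N.rcos_module_imp[OF B.is_group g' mem])
    then obtain h where h: "h \<in> L" "\<phi> (x \<otimes>\<^bsub>A\<^esub> f \<otimes>\<^bsub>A\<^esub> inv\<^bsub>A\<^esub> x \<otimes>\<^bsub>A\<^esub> inv\<^bsub>A\<^esub> g) = \<phi> h"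
      using x f g by auto
    define y where "y = x \<otimes>\<^bsub>A\<^esub> f \<otimes>\<^bsub>A\<^esub> inv\<^bsub>A\<^esub> x \<otimes>\<^bsub>A\<^esub> inv\<^bsub>A\<^esub> g"
    have y: "y \<in> carrier A" using x f g by (simp add: y_def)
    have hA: "h \<in> carrier A" using h L.subset by blast
    \<comment> \<open>Since \<open>L\<close> contains the kernel, it contains every element whose
      image lies in the image of \<open>L\<close>.\<close>
    have "y \<otimes>\<^bsub>A\<^esub> inv\<^bsub>A\<^esub> h \<in> kernel A B \<phi>"
      using y hA h(2) by (simp add: kernel_def flip: y_def)
    then have "y \<otimes>\<^bsub>A\<^esub> inv\<^bsub>A\<^esub> h \<otimes>\<^bsub>A\<^esub> h \<in> L" using L(3) h(1) by blast
    then have "y \<in> L" using y hA by (simp add: A.m_assoc)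
    then show False using L(4)[OF x(1)] by (simp add: y_def)
  qed
  then show "\<exists>(Q :: nat monoid) \<pi>. finite_group Q \<and> \<pi> \<in> epi B Q \<and> \<not> conjugate Q (\<pi> f') (\<pi> g')"
    using finite_quotient_nat[OF Q \<pi> f' g'] by blast
qed

section \<open>The surjection from \<open>\<W>\<close> for a cyclic group with generator
  \<open>a\<close>\<close>

definition wreath_hom :: "('a, 'c) monoid_scheme \<Rightarrow> 'a \<Rightarrow> laurent \<times> int \<Rightarrow> (int \<Rightarrow> 'a) \<times> int"
  where "wreath_hom C a = (\<lambda>(u, k). (\<lambda>i. a [^]\<^bsub>C\<^esub> coef u i, k))"

locale generated_by = group C for C :: "('a, 'c) monoid_scheme" (structure) +
  fixes a
  assumes a: "a \<in> carrier C" and generates: "carrier C = range (\<lambda>n :: int. a [^] n)"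
begin

text \<open>As \<open>ord a\<close> is 0 for infinite order, the kernel is \<open>d\<close>\<Lambda>
  in the finite and in the infinite case.\<close>

definition d :: int where "d = int (ord a)"

abbreviation G where "G \<equiv> wreath_int C"
abbreviation \<phi> where "\<phi> \<equiv> wreath_hom C a"

lemma restrict_UNIV: "restrict h UNIV = h"
  by (simp add: restrict_def)

lemma carrier_G: "carrier G = {x. range x \<subseteq> carrier C \<and> finite {i. x i \<noteq> \<one>}} \<times> UNIV"
  unfolding wreath_int_def semidirect_product_def
  by (auto simp: carrier_sum_group[OF group_axioms] PiE_def)

lemma mult_G: "(x, k) \<otimes>\<^bsub>G\<^esub> (y, l) = (\<lambda>i. x i \<otimes> y (i - k), k + l)"
  by (simp add: wreath_int_def semidirect_product_def shift_def restrict_UNIV)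

lemma one_G: "\<one>\<^bsub>G\<^esub> = (\<lambda>i. \<one>, 0)"
  by (simp add: wreath_int_def semidirect_product_def restrict_UNIV)

lemma wreath_hom_hom: "\<phi> \<in> hom \<W> G"
proof (rule homI)
  fix x y :: "laurent \<times> int"
  obtain u k where x: "x = (u, k)" by (cases x)
  have "finite {i. a [^] coef u i \<noteq> \<one>}"
    by (rule finite_subset[of _ "supp u"]) (auto simp: in_keys_iff)
  then show "\<phi> x \<in> carrier G"
    using a by (auto simp: x carrier_G wreath_hom_def)
  show "\<phi> (x \<otimes>\<^bsub>\<W>\<^esub> y) = \<phi> x \<otimes>\<^bsub>G\<^esub> \<phi> y"
    using a by (cases y) (simp add: x wreath_hom_def mult_G lookup_add lookup_single_mult int_pow_mult)
qed

lemma wreath_hom_surj: "\<phi> ` carrier \<W> = carrier G"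
proof
  show "\<phi> ` carrier \<W> \<subseteq> carrier G" using wreath_hom_hom by (auto simp: hom_def)
  show "carrier G \<subseteq> \<phi> ` carrier \<W>"
  proof
    fix y assume "y \<in> carrier G"
    then obtain x k where y: "y = (x, k)" "range x \<subseteq> carrier C" "finite {i. x i \<noteq> \<one>}"
      by (auto simp: carrier_G)
    \<comment> \<open>Choosing the exponent 0 wherever \<open>x i\<close> is trivial keeps the
      support of \<open>h\<close> finite.\<close>
    have "\<exists>h. \<forall>i. x i = a [^] (h i :: int) \<and> (x i = \<one> \<longrightarrow> h i = 0)"
    proof (rule choice, rule allI)
      fix i
      have "x i \<in> range (\<lambda>n :: int. a [^] n)" using y(2) generates by blast
      then show "\<exists>n :: int. x i = a [^] n \<and> (x i = \<one> \<longrightarrow> n = 0)"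
        by (cases "x i = \<one>") auto
    qed
    then obtain h where h: "\<And>i. x i = a [^] (h i :: int)" "\<And>i. x i = \<one> \<Longrightarrow> h i = 0" by blast
    have "finite {i. h i \<noteq> 0}"
      by (rule finite_subset[OF _ y(3)]) (use h(2) in auto)
    then have "coef (Abs_poly_mapping h) i = h i" for i by simp
    then have "y = \<phi> (Abs_poly_mapping h, k)"
      using h(1) by (auto simp: y(1) wreath_hom_def)
    then show "y \<in> \<phi> ` carrier \<W>" by simp
  qed
qed

text \<open>The group laws are inherited from \<open>\<W>\<close> through the surjective
  multiplicative map.\<close>

lemma group_G: "group G"
proof -
  have "\<phi> \<one>\<^bsub>\<W>\<^esub> = \<one>\<^bsub>G\<^esub>" by (simp add: wreath_hom_def one_G)
  then show ?thesis
    using int_wreath.hom_imp_img_group[OF wreath_hom_hom] unfolding wreath_hom_surj by simp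
qed

sublocale \<phi>: group_hom \<W> G \<phi>
  by (intro group_hom.intro group_hom_axioms.intro int_wreath.is_group group_G wreath_hom_hom)

lemma wreath_hom_eq_one_iff: "\<phi> x = \<one>\<^bsub>G\<^esub> \<longleftrightarrow> (\<exists>u. x = (of_int d * u, 0))"
proof -
  obtain u k where x: "x = (u, k)" by (cases x)
  have "\<phi> x = \<one>\<^bsub>G\<^esub> \<longleftrightarrow> of_int d dvd u \<and> k = 0"
    unfolding of_int_dvd_iff using a
    by (auto simp: x wreath_hom_def one_G fun_eq_iff int_pow_eq_id d_def)
  then show ?thesis by (auto simp: x dvd_def)
qed

lemma conjugacy_separable_finite_index:
  assumes H: "subgroup H G" and fin: "finite (rcosets\<^bsub>G\<^esub> H)"
  shows "conjugacy_separable (G\<lparr>carrier := H\<rparr>)"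
proof -
  define K where "K = {x. \<phi> x \<in> H}"
  interpret H: subgroup H G by fact
  have sub: "subgroup K \<W>"
    by unfold_locales (auto simp: K_def simp del: int_wreath_simps(2,3) inv_int_wreath)
  have K: "\<phi> ` K = H"
  proof
    show "H \<subseteq> \<phi> ` K"
      using H.subset unfolding wreath_hom_surj[symmetric] K_def by blast
  qed (auto simp: K_def)
  have "finite (rcosets\<^bsub>\<W>\<^esub> K)"
  proof (rule int_wreath.finite_rcosets[OF sub, of "\<lambda>x. H #>\<^bsub>G\<^esub> \<phi> x"])
    show "finite ((\<lambda>x. H #>\<^bsub>G\<^esub> \<phi> x) ` carrier \<W>)"
      by (rule finite_subset[OF _ fin]) (auto simp: RCOSETS_def intro!: bexI \<phi>.hom_closed)
    fix x y assume "x \<in> carrier \<W>" "y \<in> carrier \<W>" and eq: "H #>\<^bsub>G\<^esub> \<phi> x = H #>\<^bsub>G\<^esub> \<phi> y"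
    then have c: "\<phi> x \<in> carrier G" "\<phi> y \<in> carrier G" by auto
    have "\<phi> x \<in> H #>\<^bsub>G\<^esub> \<phi> y" using \<phi>.H.rcos_self[OF c(1) H] eq by simp
    then have "\<phi> x \<otimes>\<^bsub>G\<^esub> inv\<^bsub>G\<^esub> \<phi> y \<in> H" by (rule H.rcos_module_imp[OF group_G c(2)])
    then show "x \<otimes>\<^bsub>\<W>\<^esub> inv\<^bsub>\<W>\<^esub> y \<in> K" using \<open>x \<in> _\<close> \<open>y \<in> _\<close> by (simp add: K_def)
  qed
  moreover have "(of_int d * u, 0) \<in> K" for u
  proof -
    have "\<phi> (of_int d * u, 0) = \<one>\<^bsub>G\<^esub>" using wreath_hom_eq_one_iff by blast
    then show ?thesis using H.one_closed by (simp add: K_def)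
  qed
  ultimately interpret K: finite_index_subgroup K d
    using sub by (intro finite_index_subgroup.intro) (simp_all add: d_def)
  have hom: "\<phi> \<in> hom K.HG (G\<lparr>carrier := H\<rparr>)"
    using K \<phi>.hom_mult by (auto simp: hom_def)
  have kernel: "x \<in> kernel K.HG (G\<lparr>carrier := H\<rparr>) \<phi> \<longleftrightarrow> (\<exists>u. x = (of_int d * u, 0))" for x
    using K.of_int_d_mult by (auto simp: kernel_def wreath_hom_eq_one_iff)
  show ?thesis
  proof (rule conjugacy_separable_epi)
    show "group K.HG" by (rule K.HG.is_group)
    show "group (G\<lparr>carrier := H\<rparr>)" by (rule \<phi>.H.subgroup_imp_group[OF H])
    show "\<phi> \<in> epi K.HG (G\<lparr>carrier := H\<rparr>)" using hom K by (simp add: epi_def)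
    fix f g assume fg: "f \<in> carrier K.HG" "g \<in> carrier K.HG"
      and nc: "\<And>x. x \<in> carrier K.HG \<Longrightarrow> x \<otimes>\<^bsub>K.HG\<^esub> f \<otimes>\<^bsub>K.HG\<^esub> inv\<^bsub>K.HG\<^esub> x \<otimes>\<^bsub>K.HG\<^esub> inv\<^bsub>K.HG\<^esub> g \<notin>
        kernel K.HG (G\<lparr>carrier := H\<rparr>) \<phi>"
    have "K.separated f g"
    proof (rule K.separated_if_not_conjugate_mod)
      show "f \<in> K" using fg by simp
      fix x u assume x: "x \<in> K"
      show "x \<otimes>\<^bsub>\<W>\<^esub> f \<otimes>\<^bsub>\<W>\<^esub> inv\<^bsub>\<W>\<^esub> x \<otimes>\<^bsub>\<W>\<^esub> inv\<^bsub>\<W>\<^esub> g \<noteq> (of_int d * u, 0)"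
        using nc[of x] x fg unfolding kernel by (auto simp: K.inv_HG)
    qed
    then obtain L where L: "L \<lhd> K.HG" "finite (rcosets\<^bsub>K.HG\<^esub> L)" "\<And>u. (of_int d * u, 0) \<in> L"
      "\<And>x. x \<in> K \<Longrightarrow> x \<otimes>\<^bsub>\<W>\<^esub> f \<otimes>\<^bsub>\<W>\<^esub> inv\<^bsub>\<W>\<^esub> x \<otimes>\<^bsub>\<W>\<^esub> inv\<^bsub>\<W>\<^esub> g \<notin> L"
      unfolding K.separated_def by blast
    have "kernel K.HG (G\<lparr>carrier := H\<rparr>) \<phi> \<subseteq> L"
      by (rule subsetI) (use L(3) in \<open>auto simp: kernel\<close>)
    moreover have "x \<otimes>\<^bsub>K.HG\<^esub> f \<otimes>\<^bsub>K.HG\<^esub> inv\<^bsub>K.HG\<^esub> x \<otimes>\<^bsub>K.HG\<^esub> inv\<^bsub>K.HG\<^esub> g \<notin> L" if "x \<in> carrier K.HG" for x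
      using L(4)[of x] that fg by (simp add: K.inv_HG)
    ultimately show "\<exists>L. L \<lhd> K.HG \<and> finite (rcosets\<^bsub>K.HG\<^esub> L) \<and>
      kernel K.HG (G\<lparr>carrier := H\<rparr>) \<phi> \<subseteq> L \<and> (\<forall>x\<in>carrier K.HG.
        x \<otimes>\<^bsub>K.HG\<^esub> f \<otimes>\<^bsub>K.HG\<^esub> inv\<^bsub>K.HG\<^esub> x \<otimes>\<^bsub>K.HG\<^esub> inv\<^bsub>K.HG\<^esub> g \<notin> L)"
      using L(1,2) by blast
  qed
qed

lemma hereditarily_conjugacy_separable: "hereditarily_conjugacy_separable G"
proof -
  have "rcosets\<^bsub>G\<^esub> carrier G \<subseteq> {carrier G}"
    using \<phi>.H.coset_join2[OF _ \<phi>.H.subgroup_self] by (auto simp: RCOSETS_def)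
  then have "finite (rcosets\<^bsub>G\<^esub> carrier G)" using finite_subset by auto
  then have "conjugacy_separable (G\<lparr>carrier := carrier G\<rparr>)"
    by (rule conjugacy_separable_finite_index[OF \<phi>.H.subgroup_self])
  then show ?thesis
    unfolding hereditarily_conjugacy_separable_def using conjugacy_separable_finite_index by simp
qed

section \<open>Failure of p-conjugacy separability\<close>

lemma not_p_conjugacy_separable:
  assumes "\<not> trivial_group C" "prime p"
  shows "\<not> p_conjugacy_separable p G"
proof
  assume sep: "p_conjugacy_separable p G"
  \<comment> \<open>This is prime to the order of every finite \<open>p\<close>-group, and large
    enough for 1 - t to fit into a window of length \<open>l\<close>.\<close>
  define l where "l = int p + 1"
  have l: "l \<ge> 3" using prime_ge_2_nat[OF assms(2)] by (simp add: l_def)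
  define f g where "f = \<phi> (0, l)" and "g = \<phi> (1 - T 1, l)"
  have fg: "f \<in> carrier G" "g \<in> carrier G" by (simp_all add: f_def g_def)
  have "\<not> conjugate G f g"
  proof
    assume "conjugate G f g"
    then obtain X where X: "X \<in> carrier G" "g = X \<otimes>\<^bsub>G\<^esub> f \<otimes>\<^bsub>G\<^esub> inv\<^bsub>G\<^esub> X" by (auto simp: conjugate_def)
    obtain c j where x: "X = \<phi> (c, j)" using X(1) unfolding wreath_hom_surj[symmetric] by auto
    have "g = \<phi> ((c, j) \<otimes>\<^bsub>\<W>\<^esub> (0, l) \<otimes>\<^bsub>\<W>\<^esub> inv\<^bsub>\<W>\<^esub> (c, j))"
      unfolding X(2) x f_def by (simp del: int_wreath_simps(2) inv_int_wreath)
    then have "\<phi> ((c, j) \<otimes>\<^bsub>\<W>\<^esub> (0, l) \<otimes>\<^bsub>\<W>\<^esub> inv\<^bsub>\<W>\<^esub> (c, j) \<otimes>\<^bsub>\<W>\<^esub> inv\<^bsub>\<W>\<^esub> (1 - T 1, l)) = \<one>\<^bsub>G\<^esub>"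
      using fg(2) unfolding g_def by (simp del: int_wreath_simps(2) inv_int_wreath)
    then obtain u where "c - T l * c - (1 - T 1) = of_int d * u"
      unfolding conj_mult_inv_int_wreath wreath_hom_eq_one_iff by auto
    then have "(1 - T 1) - of_int d * (- u) = (1 - T l) * c"
      by (simp add: algebra_simps)
    then have "1 - T l dvd (1 - T 1) - of_int d * (- u)" by (rule dvdI)
    moreover have "supp (1 - T 1) \<subseteq> {0..<0 + \<bar>l\<bar>}"
      using keys_diff[of "1 :: laurent" "T 1"] l by auto
    ultimately have "of_int d dvd (1 - T 1)"
      using of_int_dvd_if_short[of l "1 - T 1" _ "- u" 0] l by simp
    then have "d dvd coef (1 - T 1) 0" unfolding of_int_dvd_iff by blast
    \<comment> \<open>The constant coefficient of 1 - t is 1.\<close>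
    then have "ord a = 1" by (simp add: d_def lookup_minus lookup_single_not_eq)
    then have "a = \<one>" using a ord_eq_1 by simp
    then have "carrier C = {\<one>}" unfolding generates by simp
    then show False using assms(1) by (simp add: trivial_group_def is_group)
  qed
  then obtain Q :: "nat monoid" and \<pi> where Q: "finite_p_group p Q" and \<pi>: "\<pi> \<in> epi G Q"
    and nc: "\<not> conjugate Q (\<pi> f) (\<pi> g)"
    using sep fg unfolding p_conjugacy_separable_def by blast
  obtain n where n: "order Q = p ^ n" and gQ: "group Q"
    using Q unfolding finite_p_group_def finite_group_def by blast
  define \<rho> where "\<rho> = \<pi> \<circ> \<phi>"
  have "\<rho> \<in> hom \<W> Q"
    unfolding \<rho>_def by (rule Group.hom_compose[OF wreath_hom_hom]) (use \<pi> in \<open>simp add: epi_def\<close>)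
  then interpret \<rho>: group_hom \<W> Q \<rho>
    by (intro group_hom.intro group_hom_axioms.intro int_wreath.is_group gQ)
  have "coprime l (int (order Q))"
    unfolding n l_def by simp
  then obtain s v where "s * l + v * int (order Q) = 1"
    using bezout_int[of l "int (order Q)"] by (auto simp: coprime_iff_gcd_eq_1)
  \<comment> \<open>Hence t and (t^l)^s have the same image in \<open>Q\<close>.\<close>
  then have t: "l * s = 1 + int (order Q) * - v" by (simp add: algebra_simps)
  have "\<rho> (0, int (order Q)) = \<one>\<^bsub>Q\<^esub>"
    using \<rho>.hom_nat_pow[of "(0, 1)" "order Q"] \<rho>.H.pow_order_eq_1[of "\<rho> (0, 1)"]
    by (simp add: pow_int_wreath_top)
  then have one: "\<rho> (0, int (order Q) * - v) = \<one>\<^bsub>Q\<^esub>"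
    using \<rho>.hom_int_pow[of "(0, int (order Q))" "- v"] by (simp add: int_pow_int_wreath_top)
  have "\<rho> (0, l * s) = \<rho> ((0, 1) \<otimes>\<^bsub>\<W>\<^esub> (0, int (order Q) * - v))" by (simp only: int_wreath_simps t) simp
  also have "\<dots> = \<rho> (0, 1) \<otimes>\<^bsub>Q\<^esub> \<rho> (0, int (order Q) * - v)" by (rule \<rho>.hom_mult) simp_all
  finally have ls: "\<rho> (0, l * s) = \<rho> (0, 1)" unfolding one by simp
  \<comment> \<open>The commutator of \<open>(1, 0)\<close> and \<open>(0, k)\<close> is
    \<open>(1 - T k, 0)\<close>, so the image of \<open>(1 - T k, l)\<close> depends only on that of
    \<open>(0, k)\<close>.\<close>
  have comm: "\<rho> (1 - T k, l) = \<rho> (1, 0) \<otimes>\<^bsub>Q\<^esub> \<rho> (0, k) \<otimes>\<^bsub>Q\<^esub> inv\<^bsub>Q\<^esub> \<rho> (1, 0) \<otimes>\<^bsub>Q\<^esub> inv\<^bsub>Q\<^esub> \<rho> (0, k) \<otimes>\<^bsub>Q\<^esub> \<rho> (0, l)" for k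
  proof -
    have "(1 - T k, l) = (1, 0) \<otimes>\<^bsub>\<W>\<^esub> (0, k) \<otimes>\<^bsub>\<W>\<^esub> inv\<^bsub>\<W>\<^esub> (1, 0) \<otimes>\<^bsub>\<W>\<^esub> inv\<^bsub>\<W>\<^esub> (0, k) \<otimes>\<^bsub>\<W>\<^esub> (0, l)"
      unfolding conj_mult_inv_int_wreath by simp
    then show ?thesis by (simp del: int_wreath_simps(2) inv_int_wreath)
  qed
  have \<rho>f: "\<pi> f = \<rho> (0, l)" and \<rho>g: "\<pi> g = \<rho> (1 - T 1, l)"
    by (simp_all add: f_def g_def \<rho>_def)
  \<comment> \<open>Conjugation by \<open>(w, 0)\<close> sends \<open>(0, l)\<close> to
    \<open>((1 - T l) * w, l)\<close>; this \<open>w\<close> produces 1 - t^(l s).\<close>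
  let ?z = "(geom l s, 0)"
  have "\<rho> (1 - T 1, l) = \<rho> (1 - T (l * s), l)"
    unfolding comm ls ..
  also have "(1 - T (l * s), l) = ?z \<otimes>\<^bsub>\<W>\<^esub> (0, l) \<otimes>\<^bsub>\<W>\<^esub> inv\<^bsub>\<W>\<^esub> ?z"
    unfolding conj_int_wreath by (simp add: left_diff_distrib flip: geom)
  finally have "\<pi> g = \<rho> ?z \<otimes>\<^bsub>Q\<^esub> \<pi> f \<otimes>\<^bsub>Q\<^esub> inv\<^bsub>Q\<^esub> \<rho> ?z"
    unfolding \<rho>f \<rho>g by (simp del: int_wreath_simps(2) inv_int_wreath)
  then show False using nc \<rho>.hom_closed[of ?z] unfolding conjugate_def by auto
qed

end

text \<open>For trivial \<open>C\<close> the wreath product is infinite cyclic, hence abelian and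
  residually a finite \<open>p\<close>-group, as are its nontrivial subgroups; the second claim
  therefore asks for nontrivial \<open>C\<close>.\<close>

theorem corollary1p6:
  fixes C :: "'a monoid"
  assumes "group C" and "cyclic_group C"
  shows "hereditarily_conjugacy_separable (wreath_int C) \<and>
    (\<not> trivial_group C \<longrightarrow>
      (\<forall>p::nat. prime p \<longrightarrow> \<not> p_hereditarily_conjugacy_separable p (wreath_int C)))"
proof -
  interpret group C by fact
  obtain a where "a \<in> carrier C" "carrier C = range (\<lambda>n :: int. a [^]\<^bsub>C\<^esub> n)"
    using assms(2) unfolding cyclic_group by blast
  then interpret generated_by C a by unfold_locales
  show ?thesis
    using hereditarily_conjugacy_separable not_p_conjugacy_separable
    unfolding p_hereditarily_conjugacy_separable_def by blast
qed

end
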